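(* Let $n$ and $\Delta$ be positive integers such that $\Delta\ge \frac{3(n-1)}{4}$. If $G$ is obtained from an $(n-1)$-vertex $\Delta$-regular Class 1 graph by a vertex-splitting, then $G$ is $\Delta$-critical.
   Context: All graphs are finite and simple. For a graph $G$ with maximum degree $\Delta(G)$, the chromatic index $\chi'(G)$ is the least $k$ such that $E(G)$ can be properly edge-colored with $k$ colors; $G$ is Class 1 if $\chi'(G)=\Delta(G)$ and Class 2 otherwise. A graph $G$ is $\Delta$-critical (with $\Delta=\Delta(G)$) if $\chi'(G)=\Delta+1$ and $\chi'(H)<\Delta+1$ for every proper subgraph $H$ of $G$. Vertex-splitting: let $v$ be a vertex of $G$ with $d_G(v)=t\ge 2$ and $N_G(v)=\{u_1,\dots,u_t\}$; splitting $v$ into two new vertices $v_1,v_2$ gives the graph $G'$ with $V(G')=(V(G)\setminus\{v\})\cup\{v_1,v_2\}$ and $E(G')=E(G-v)\cup\{v_1v_2\}\cup\{v_1u_i: i\in[1,s]\}\cup\{v_2u_i: i\in[s+1,t]\}$ for some integer $s\in[1,t-1]$. *)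

theory Defs
  imports Complex_Main
begin

record 'a ugraph =
  verts :: "'a set"
  edges :: "'a set set"

definition simple_graph :: "'a ugraph \<Rightarrow> bool" where
  "simple_graph G \<longleftrightarrow>
     finite (verts G) \<and>
     (\<forall>e\<in>edges G. \<exists>x\<in>verts G. \<exists>y\<in>verts G. x \<noteq> y \<and> e = {x, y})"

definition neighbors :: "'a ugraph \<Rightarrow> 'a \<Rightarrow> 'a set" where
  "neighbors G v = {u \<in> verts G. {v, u} \<in> edges G}"

definition degree :: "'a ugraph \<Rightarrow> 'a \<Rightarrow> nat" where
  "degree G v = card (neighbors G v)"

text \<open>The inserted 0 only matters for the graph without vertices.\<close>

definition max_degree :: "'a ugraph \<Rightarrow> nat" where
  "max_degree G = Max (insert 0 (degree G ` verts G))"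

definition regular :: "nat \<Rightarrow> 'a ugraph \<Rightarrow> bool" where
  "regular d G \<longleftrightarrow> (\<forall>v\<in>verts G. degree G v = d)"

definition subgraph :: "'a ugraph \<Rightarrow> 'a ugraph \<Rightarrow> bool" where
  "subgraph H G \<longleftrightarrow>
     simple_graph H \<and> verts H \<subseteq> verts G \<and> edges H \<subseteq> edges G"

definition proper_edge_coloring :: "'a ugraph \<Rightarrow> nat \<Rightarrow> ('a set \<Rightarrow> nat) \<Rightarrow> bool" where
  "proper_edge_coloring G k c \<longleftrightarrow>
     c ` edges G \<subseteq> {..<k} \<and>
     (\<forall>e\<in>edges G. \<forall>f\<in>edges G. e \<noteq> f \<and> e \<inter> f \<noteq> {} \<longrightarrow> c e \<noteq> c f)"

definition chromatic_index :: "'a ugraph \<Rightarrow> nat" where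
  "chromatic_index G = (LEAST k. \<exists>c. proper_edge_coloring G k c)"

definition class1 :: "'a ugraph \<Rightarrow> bool" where
  "class1 G \<longleftrightarrow> chromatic_index G = max_degree G"

definition critical :: "nat \<Rightarrow> 'a ugraph \<Rightarrow> bool" where
  "critical d G \<longleftrightarrow>
     simple_graph G \<and> max_degree G = d \<and> chromatic_index G = d + 1 \<and>
     (\<forall>H. subgraph H G \<and> H \<noteq> G \<longrightarrow> chromatic_index H < d + 1)"

text \<open>
  \<open>vertex_splitting G G'\<close>: the graph \<open>G'\<close> arises from \<open>G\<close> by splitting some vertex \<open>v\<close>
  of degree \<open>t\<close> at least 2 into \<open>v\<^sub>1\<close> and \<open>v\<^sub>2\<close>. The function \<open>u\<close> enumerates the
  neighborhood of \<open>v\<close> in an arbitrary order as \<open>u 1, ..., u t\<close>.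
\<close>

definition vertex_splitting :: "'a ugraph \<Rightarrow> 'a ugraph \<Rightarrow> bool" where
  "vertex_splitting G G' \<longleftrightarrow>
     (\<exists>v v\<^sub>1 v\<^sub>2 u t s.
        v \<in> verts G \<and> degree G v = t \<and> t \<ge> 2 \<and>
        bij_betw u {1..t} (neighbors G v) \<and>
        v\<^sub>1 \<notin> verts G \<and> v\<^sub>2 \<notin> verts G \<and> v\<^sub>1 \<noteq> v\<^sub>2 \<and>
        s \<in> {1..t - 1} \<and>
        verts G' = (verts G - {v}) \<union> {v\<^sub>1, v\<^sub>2} \<and>
        edges G' = {e \<in> edges G. v \<notin> e} \<union> {{v\<^sub>1, v\<^sub>2}}
                   \<union> {{v\<^sub>1, u i} | i. i \<in> {1..s}}
                   \<union> {{v\<^sub>2, u i} | i. i \<in> {s + 1..t}})"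

end

theory Submission
  imports Defs "HOL-Combinatorics.Transposition"
begin

text \<open>
  In a 1-factorization of the regular graph every colour is present at exactly one of the two
  halves \<open>a\<close>, \<open>b\<close> of the split vertex, and only the edge \<open>ab\<close> is uncoloured. The new graph has
  odd order and, apart from \<open>a\<close> and \<open>b\<close>, all degrees \<open>\<Delta>\<close>, so a \<open>\<Delta>\<close>-colouring would have the colour
  of \<open>ab\<close> at every vertex, which is impossible by parity.

  To colour the graph without an edge \<open>xy\<close>, start from the same colouring; now \<open>x\<close> and \<open>y\<close> miss a
  common colour. If the graph were not colourable, every Kempe chain from \<open>a\<close> in a colour missing at
  \<open>a\<close> and one missing at \<open>b\<close> would end at \<open>b\<close>, so that flipping all other chains changes the colour
  missing at \<open>x\<close> without disturbing \<open>a\<close> and \<open>b\<close>. This already gives a contradiction when \<open>x\<close> is adjacent to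
  the split vertex, or has a common neighbour with it on the side of \<open>b\<close> while \<open>b\<close> misses two colours.
  There remains the case in which \<open>a\<close> has only one further neighbour \<open>c\<close>. As the degrees are at least
  three quarters of the order, \<open>b\<close>, \<open>c\<close>, \<open>x\<close> and \<open>y\<close> have a common neighbour \<open>w\<close>; the uncoloured edge can
  then be moved to \<open>wx\<close> or \<open>wy\<close> through \<open>b\<close> or through \<open>c\<close>, and these four routes cannot all be blocked.
\<close>

subsection \<open>Partial edge colourings and Kempe components\<close>

definition proper_map :: "('a set \<rightharpoonup> nat) \<Rightarrow> bool" where
  "proper_map c \<longleftrightarrow>
     (\<forall>e e' \<alpha>. c e = Some \<alpha> \<and> c e' = Some \<alpha> \<and> e \<inter> e' \<noteq> {} \<longrightarrow> e = e')"

text \<open>\<open>E\<close> is the exact domain, so leaving an edge \<open>e\<close> uncoloured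
  means colouring \<open>E - {e}\<close>, and colouring it later is a map update.\<close>

definition colors :: "nat \<Rightarrow> 'a set set \<Rightarrow> ('a set \<rightharpoonup> nat) \<Rightarrow> bool" where
  "colors k E c \<longleftrightarrow> dom c = E \<and> ran c \<subseteq> {..<k} \<and> proper_map c"

definition miss :: "('a set \<rightharpoonup> nat) \<Rightarrow> 'a \<Rightarrow> nat \<Rightarrow> bool" where
  "miss c v \<alpha> \<longleftrightarrow> (\<forall>e. v \<in> e \<longrightarrow> c e \<noteq> Some \<alpha>)"

text \<open>These sets are the unions of Kempe components. Unlike single components they are stable
  under complement, which allows flipping all chains but one.\<close>

definition kempe_closed :: "('a set \<rightharpoonup> nat) \<Rightarrow> nat \<Rightarrow> nat \<Rightarrow> 'a set \<Rightarrow> bool" where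
  "kempe_closed c \<alpha> \<beta> S \<longleftrightarrow>
     (\<forall>e. c e = Some \<alpha> \<or> c e = Some \<beta> \<longrightarrow> e \<inter> S \<noteq> {} \<longrightarrow> e \<subseteq> S)"

definition kempe_rel :: "('a set \<rightharpoonup> nat) \<Rightarrow> nat \<Rightarrow> nat \<Rightarrow> ('a \<times> 'a) set" where
  "kempe_rel c \<alpha> \<beta> = {(p, q). \<exists>e. (c e = Some \<alpha> \<or> c e = Some \<beta>) \<and> p \<in> e \<and> q \<in> e}"

definition kempe_comp :: "('a set \<rightharpoonup> nat) \<Rightarrow> nat \<Rightarrow> nat \<Rightarrow> 'a \<Rightarrow> 'a set" where
  "kempe_comp c \<alpha> \<beta> r = (kempe_rel c \<alpha> \<beta>)\<^sup>* `` {r}"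

text \<open>The transposition fixes all other colours, so for a Kempe closed \<open>S\<close> the
  edges that really change are those inside \<open>S\<close>.\<close>

definition kempe_swap :: "nat \<Rightarrow> nat \<Rightarrow> 'a set \<Rightarrow> ('a set \<rightharpoonup> nat) \<Rightarrow> ('a set \<rightharpoonup> nat)" where
  "kempe_swap \<alpha> \<beta> S c =
     (\<lambda>e. if e \<inter> S \<noteq> {} then map_option (transpose \<alpha> \<beta>) (c e) else c e)"

section \<open>Missing colours and recolouring a single edge\<close>

lemma miss_uncolor: "miss c v \<alpha> \<Longrightarrow> miss (c(e := None)) v \<alpha>"
  by (auto simp: miss_def)

lemma miss_uncolor_same:
  "proper_map c \<Longrightarrow> c e = Some \<alpha> \<Longrightarrow> v \<in> e \<Longrightarrow> miss (c(e := None)) v \<alpha>"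
  by (auto simp: miss_def proper_map_def)

lemma miss_upd:
  "miss c v \<alpha> \<Longrightarrow> v \<notin> e \<or> \<alpha> \<noteq> \<beta> \<Longrightarrow> miss (c(e \<mapsto> \<beta>)) v \<alpha>"
  by (auto simp: miss_def)

lemma not_missI: "c e = Some \<alpha> \<Longrightarrow> v \<in> e \<Longrightarrow> \<not> miss c v \<alpha>"
  by (auto simp: miss_def)

lemma proper_map_inj:
  "proper_map c \<Longrightarrow> c e = Some \<alpha> \<Longrightarrow> c e' = Some \<alpha> \<Longrightarrow> v \<in> e \<Longrightarrow> v \<in> e' \<Longrightarrow> e = e'"
  unfolding proper_map_def by blast

lemma proper_map_uncolor: "proper_map c \<Longrightarrow> proper_map (c(e := None))"
  unfolding proper_map_def by simp

lemma proper_map_color: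
  assumes "proper_map c" "\<And>v. v \<in> e \<Longrightarrow> miss c v \<alpha>"
  shows "proper_map (c(e \<mapsto> \<alpha>))"
  unfolding proper_map_def
proof (intro allI impI, elim conjE)
  fix e1 e2 \<gamma>
  assume *: "(c(e \<mapsto> \<alpha>)) e1 = Some \<gamma>" "(c(e \<mapsto> \<alpha>)) e2 = Some \<gamma>" "e1 \<inter> e2 \<noteq> {}"
  then obtain v where v: "v \<in> e1" "v \<in> e2" by blast
  show "e1 = e2"
  proof (rule ccontr)
    assume ne: "e1 \<noteq> e2"
    consider "e1 = e" | "e2 = e" | "e1 \<noteq> e" "e2 \<noteq> e" by blast
    then show False
    proof cases
      case 1
      then show False using * v ne assms(2)[of v] by (simp add: miss_def)
    next
      case 2
      then show False using * v ne assms(2)[of v] by (simp add: miss_def)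
    next
      case 3
      then show False using * v ne proper_map_inj[OF assms(1)] by simp
    qed
  qed
qed

lemma colors_uncolor: "colors k E c \<Longrightarrow> colors k (E - {e}) (c(e := None))"
  unfolding colors_def using proper_map_uncolor[of c e] by (auto simp: ran_def)

lemma colors_color:
  assumes "colors k (E - {e}) c" "e \<in> E" "\<And>v. v \<in> e \<Longrightarrow> miss c v \<alpha>" "\<alpha> < k"
  shows "colors k E (c(e \<mapsto> \<alpha>))"
  using assms proper_map_color[of c e \<alpha>] unfolding colors_def by (auto simp: ran_def)

lemma colors_lt: "colors k E c \<Longrightarrow> c e = Some \<alpha> \<Longrightarrow> \<alpha> < k"
  unfolding colors_def by (auto simp: ran_def)

lemma colors_None: "colors k E c \<Longrightarrow> e \<notin> E \<Longrightarrow> c e = None"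
  unfolding colors_def by blast

lemma colors_proper: "colors k E c \<Longrightarrow> proper_map c"
  unfolding colors_def by blast

section \<open>Kempe closed sets, components and swaps\<close>

lemma kempe_closedD:
  "kempe_closed c \<alpha> \<beta> S \<Longrightarrow> c e = Some \<alpha> \<or> c e = Some \<beta> \<Longrightarrow> e \<inter> S \<noteq> {} \<Longrightarrow> e \<subseteq> S"
  unfolding kempe_closed_def by blast

lemma kempe_closed_Compl: "kempe_closed c \<alpha> \<beta> S \<Longrightarrow> kempe_closed c \<alpha> \<beta> (- S)"
  unfolding kempe_closed_def by blast

lemma kempe_comp_refl: "r \<in> kempe_comp c \<alpha> \<beta> r"
  unfolding kempe_comp_def by blast

lemma kempe_closed_comp: "kempe_closed c \<alpha> \<beta> (kempe_comp c \<alpha> \<beta> r)"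
  unfolding kempe_closed_def kempe_comp_def
proof (intro allI impI subsetI)
  fix e q assume e: "c e = Some \<alpha> \<or> c e = Some \<beta>" "e \<inter> (kempe_rel c \<alpha> \<beta>)\<^sup>* `` {r} \<noteq> {}" "q \<in> e"
  then obtain p where "p \<in> e" "(r, p) \<in> (kempe_rel c \<alpha> \<beta>)\<^sup>*" by blast
  moreover have "(p, q) \<in> kempe_rel c \<alpha> \<beta>" using e \<open>p \<in> e\<close> unfolding kempe_rel_def by blast
  ultimately show "q \<in> (kempe_rel c \<alpha> \<beta>)\<^sup>* `` {r}" by (auto intro: rtrancl_into_rtrancl)
qed

lemma kempe_comp_least:
  assumes "kempe_closed c \<alpha> \<beta> S" "r \<in> S"
  shows "kempe_comp c \<alpha> \<beta> r \<subseteq> S"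
proof
  fix p assume "p \<in> kempe_comp c \<alpha> \<beta> r"
  then have "(r, p) \<in> (kempe_rel c \<alpha> \<beta>)\<^sup>*" unfolding kempe_comp_def by blast
  then show "p \<in> S"
    by (induction rule: rtrancl_induct)
      (use assms in \<open>auto simp: kempe_rel_def kempe_closed_def\<close>)
qed

text \<open>A component depends only on the union of the two colour classes. This transfers chains
  between colourings that differ in other colours.\<close>

lemma kempe_comp_cong:
  assumes "\<And>e. c e = Some \<alpha> \<or> c e = Some \<beta> \<longleftrightarrow> c' e = Some \<alpha> \<or> c' e = Some \<beta>"
  shows "kempe_comp c \<alpha> \<beta> r = kempe_comp c' \<alpha> \<beta> r"
  unfolding kempe_comp_def kempe_rel_def using assms by simp

text \<open>An edge in one of the two colours that met \<open>S\<close> would lie in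
  \<open>S\<close> together with \<open>v\<close>; any other colour is fixed.\<close>

lemma kempe_swap_outside:
  assumes "kempe_closed c \<alpha> \<beta> S" "v \<in> e" "v \<notin> S"
  shows "kempe_swap \<alpha> \<beta> S c e = c e"
proof (cases "c e = Some \<alpha> \<or> c e = Some \<beta>")
  case True
  then show ?thesis using assms unfolding kempe_swap_def kempe_closed_def by auto
next
  case False
  then show ?thesis unfolding kempe_swap_def by (cases "c e") auto
qed

lemma kempe_swap_inside:
  "v \<in> e \<Longrightarrow> v \<in> S \<Longrightarrow> kempe_swap \<alpha> \<beta> S c e = map_option (transpose \<alpha> \<beta>) (c e)"
  unfolding kempe_swap_def by auto

lemma kempe_swap_other:
  "\<gamma> \<noteq> \<alpha> \<Longrightarrow> \<gamma> \<noteq> \<beta> \<Longrightarrow> kempe_swap \<alpha> \<beta> S c e = Some \<gamma> \<longleftrightarrow> c e = Some \<gamma>"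
  unfolding kempe_swap_def by (auto simp: transpose_def)

lemma kempe_swap_miss:
  assumes "kempe_closed c \<alpha> \<beta> S"
  shows "miss (kempe_swap \<alpha> \<beta> S c) v \<gamma> \<longleftrightarrow> miss c v (if v \<in> S then transpose \<alpha> \<beta> \<gamma> else \<gamma>)"
proof (cases "v \<in> S")
  case True
  then have "\<And>e. v \<in> e \<Longrightarrow> kempe_swap \<alpha> \<beta> S c e = Some \<gamma> \<longleftrightarrow> c e = Some (transpose \<alpha> \<beta> \<gamma>)"
    by (auto simp: kempe_swap_inside)
  then show ?thesis using True by (auto simp: miss_def)
next
  case False
  then have "\<And>e. v \<in> e \<Longrightarrow> kempe_swap \<alpha> \<beta> S c e = c e"
    using kempe_swap_outside[OF assms] by blast
  then show ?thesis using False by (auto simp: miss_def)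
qed

text \<open>At a vertex of \<open>S\<close> all colours are permuted by one bijection, at a vertex
  outside nothing changes, so no conflict arises at either.\<close>

lemma colors_kempe_swap:
  assumes "kempe_closed c \<alpha> \<beta> S" "colors k E c" "\<alpha> < k" "\<beta> < k"
  shows "colors k E (kempe_swap \<alpha> \<beta> S c)"
proof -
  have "dom (kempe_swap \<alpha> \<beta> S c) = dom c"
    unfolding kempe_swap_def by (auto simp: dom_def split: if_splits)
  moreover have "ran (kempe_swap \<alpha> \<beta> S c) \<subseteq> {..<k}"
    using assms unfolding colors_def kempe_swap_def
    by (auto simp: ran_def transpose_def split: if_splits)
  moreover have "proper_map (kempe_swap \<alpha> \<beta> S c)"
    unfolding proper_map_def
  proof (intro allI impI, elim conjE)
    fix e e' \<gamma>
    assume *: "kempe_swap \<alpha> \<beta> S c e = Some \<gamma>" "kempe_swap \<alpha> \<beta> S c e' = Some \<gamma>" "e \<inter> e' \<noteq> {}"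
    then obtain v where v: "v \<in> e" "v \<in> e'" by blast
    have p: "proper_map c" using assms(2) by (rule colors_proper)
    show "e = e'"
    proof (cases "v \<in> S")
      case True
      then have "c e = Some (transpose \<alpha> \<beta> \<gamma>)" "c e' = Some (transpose \<alpha> \<beta> \<gamma>)"
        using *(1,2) v by (simp_all add: kempe_swap_inside) (metis transpose_involutory)+
      then show ?thesis using proper_map_inj[OF p] v by blast
    next
      case False
      then have "c e = Some \<gamma>" "c e' = Some \<gamma>"
        using * v kempe_swap_outside[OF assms(1)] by metis+
      then show ?thesis using proper_map_inj[OF p] v by blast
    qed
  qed
  ultimately show ?thesis using assms(2) unfolding colors_def by simp
qed

section \<open>Kempe components as paths and cycles\<close>

lemma card2_other: "card e = 2 \<Longrightarrow> p \<in> e \<Longrightarrow> q \<in> e \<Longrightarrow> q' \<in> e \<Longrightarrow> q \<noteq> p \<Longrightarrow> q' \<noteq> p \<Longrightarrow> q = q'"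
  by (auto simp: card_2_iff)

text \<open>Properness allows at most one edge of each of the two colours at \<open>p\<close>. The
  neighbours must differ from \<open>p\<close> because \<open>kempe_rel\<close> relates a covered
  vertex also to itself.\<close>

lemma kempe_rel_two:
  assumes "proper_map c" "\<And>e. e \<in> dom c \<Longrightarrow> card e = 2"
    and "(p, q1) \<in> kempe_rel c \<alpha> \<beta>" "(p, q2) \<in> kempe_rel c \<alpha> \<beta>" "(p, q3) \<in> kempe_rel c \<alpha> \<beta>"
    and "q1 \<noteq> p" "q2 \<noteq> p" "q3 \<noteq> p" "q1 \<noteq> q2"
  shows "q3 = q1 \<or> q3 = q2"
proof -
  from assms(3) obtain e1 where e1: "c e1 = Some \<alpha> \<or> c e1 = Some \<beta>" "p \<in> e1" "q1 \<in> e1"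
    unfolding kempe_rel_def by blast
  from assms(4) obtain e2 where e2: "c e2 = Some \<alpha> \<or> c e2 = Some \<beta>" "p \<in> e2" "q2 \<in> e2"
    unfolding kempe_rel_def by blast
  from assms(5) obtain e3 where e3: "c e3 = Some \<alpha> \<or> c e3 = Some \<beta>" "p \<in> e3" "q3 \<in> e3"
    unfolding kempe_rel_def by blast
  have card: "card e1 = 2" "card e2 = 2" "card e3 = 2" using assms(2) e1 e2 e3 by blast+
  have "e1 \<noteq> e2" using card2_other[OF card(1)] e1 e2 assms by blast
  then have "e3 = e1 \<or> e3 = e2" using proper_map_inj[OF assms(1)] e1 e2 e3 by metis
  then show ?thesis
    using card2_other[OF card(1) e1(2)] card2_other[OF card(2) e2(2)] e1 e2 e3 assms by blast
qed

lemma kempe_rel_end: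
  assumes "proper_map c" "\<And>e. e \<in> dom c \<Longrightarrow> card e = 2" "miss c p \<alpha> \<or> miss c p \<beta>"
    and "(p, q1) \<in> kempe_rel c \<alpha> \<beta>" "(p, q2) \<in> kempe_rel c \<alpha> \<beta>" "q1 \<noteq> p" "q2 \<noteq> p"
  shows "q1 = q2"
proof -
  from assms(4) obtain e1 where e1: "c e1 = Some \<alpha> \<or> c e1 = Some \<beta>" "p \<in> e1" "q1 \<in> e1"
    unfolding kempe_rel_def by blast
  from assms(5) obtain e2 where e2: "c e2 = Some \<alpha> \<or> c e2 = Some \<beta>" "p \<in> e2" "q2 \<in> e2"
    unfolding kempe_rel_def by blast
  have card: "card e1 = 2" using assms(2) e1 by blast
  have "e1 = e2" using assms(3) proper_map_inj[OF assms(1)] e1 e2 unfolding miss_def by metis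
  then show ?thesis using card2_other[OF card] e1 e2 assms by blast
qed

text \<open>Two colour classes form a graph of maximum degree 2, so a component is a path or a cycle
  and has at most two ends. Concretely, a shortest walk from \<open>r\<close> to \<open>p\<close> is
  already closed, hence contains the component, and a third end would be an inner vertex of
  it.\<close>

lemma kempe_comp_three_ends:
  assumes pr: "proper_map c" and c2: "\<And>e. e \<in> dom c \<Longrightarrow> card e = 2"
    and r: "miss c r \<alpha> \<or> miss c r \<beta>" and p: "miss c p \<alpha> \<or> miss c p \<beta>"
    and q: "miss c q \<alpha> \<or> miss c q \<beta>"
    and "r \<noteq> p" "r \<noteq> q" "p \<noteq> q" "p \<in> kempe_comp c \<alpha> \<beta> r"
  shows "q \<notin> kempe_comp c \<alpha> \<beta> r"
proof
  let ?R = "kempe_rel c \<alpha> \<beta>"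
  assume qin: "q \<in> kempe_comp c \<alpha> \<beta> r"
  have sym: "(s, t) \<in> ?R \<Longrightarrow> (t, s) \<in> ?R" for s t unfolding kempe_rel_def by blast
  define m where "m = (LEAST n. (r, p) \<in> ?R ^^ n)"
  have ex: "\<exists>n. (r, p) \<in> ?R ^^ n" using assms(9) rtrancl_imp_relpow unfolding kempe_comp_def by fastforce
  have "(r, p) \<in> ?R ^^ m" unfolding m_def using ex by (rule LeastI_ex)
  then obtain z where z: "z 0 = r" "z m = p" "\<And>i. i < m \<Longrightarrow> (z i, z (Suc i)) \<in> ?R"
    unfolding relpow_fun_conv by blast
  have minim: "m \<le> n" if "(r, p) \<in> ?R ^^ n" for n unfolding m_def using that by (rule Least_le)
  have walk: "(z i, z (i + d)) \<in> ?R ^^ d" if "i + d \<le> m" for i d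
    using that by (induction d) (auto intro!: relcompI z(3))
  \<comment> \<open>A repeated vertex would allow a shortcut, against the minimality of
    \<open>m\<close>.\<close>
  have inj: "z i \<noteq> z j" if "i < j" "j \<le> m" for i j
  proof
    assume eq: "z i = z j"
    have "(r, z i) \<in> ?R ^^ i" using walk[of 0 i] z that by simp
    moreover have "(z i, p) \<in> ?R ^^ (m - j)" using walk[of j "m - j"] z that eq by simp
    ultimately have "(r, p) \<in> ?R ^^ (i + (m - j))" unfolding relpow_add by blast
    then show False using minim[of "i + (m - j)"] that by linarith
  qed
  have m0: "m > 0" using z assms(6) by (cases m) auto
  let ?Z = "z ` {..m}"
  \<comment> \<open>Predecessor and successor on the walk already use up the neighbours that a
    vertex can have: one at either end, two in between.\<close>
  have step: "t \<in> ?Z" if "i \<le> m" "(z i, t) \<in> ?R" "t \<noteq> z i" for i t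
  proof -
    consider "i = 0" | "i = m" | "0 < i" "i < m" using \<open>i \<le> m\<close> by linarith
    then show ?thesis
    proof cases
      case 1
      have "t = z 1"
        by (rule kempe_rel_end[OF pr c2 r])
          (use that 1 z m0 z(3)[of 0] inj[of 0 1] in auto)
      then show ?thesis using m0 by auto
    next
      case 2
      have "t = z (m - 1)"
        by (rule kempe_rel_end[OF pr c2 p])
          (use that 2 z m0 sym[OF z(3)[of "m - 1"]] inj[of "m - 1" m] in auto)
      then show ?thesis by auto
    next
      case 3
      have "t = z (i - 1) \<or> t = z (Suc i)"
        by (rule kempe_rel_two[OF pr c2, of "z i" _ \<alpha> \<beta>])
          (use that 3 sym[OF z(3)[of "i - 1"]] z(3)[of i] inj[of "i - 1" i] inj[of i "Suc i"]
            inj[of "i - 1" "Suc i"] in auto)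
      then show ?thesis using 3 by auto
    qed
  qed
  have "kempe_closed c \<alpha> \<beta> ?Z"
    unfolding kempe_closed_def
  proof (intro allI impI subsetI)
    fix e t assume e: "c e = Some \<alpha> \<or> c e = Some \<beta>" "e \<inter> ?Z \<noteq> {}" "t \<in> e"
    then obtain i where i: "i \<le> m" "z i \<in> e" by auto
    show "t \<in> ?Z"
    proof (cases "t = z i")
      case False
      then show ?thesis using step[OF i(1)] e i unfolding kempe_rel_def by blast
    qed (use i in auto)
  qed
  then have "kempe_comp c \<alpha> \<beta> r \<subseteq> ?Z"
    by (rule kempe_comp_least) (use z in auto)
  then obtain i where i: "q = z i" "i \<le> m" using qin by auto
  then have i': "0 < i" "i < m" using z assms(7,8) by (metis gr0I, metis le_neq_implies_less)
  \<comment> \<open>An inner vertex missing one of the colours has a single neighbour, so its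
    predecessor and successor would coincide.\<close>
  have "z (i - 1) = z (Suc i)"
    by (rule kempe_rel_end[OF pr c2 q])
      (use i i' sym[OF z(3)[of "i - 1"]] z(3)[of i] inj[of "i - 1" i] inj[of i "Suc i"] in auto)
  then show False using inj[of "i - 1" "Suc i"] i' by linarith
qed

text \<open>The edges of colour \<open>\<alpha>\<close> that meet \<open>S\<close> lie in
  \<open>S\<close> and partition its saturated vertices into pairs.\<close>

lemma even_card_saturated:
  assumes "proper_map c" "\<And>e. e \<in> dom c \<Longrightarrow> card e = 2" "finite S"
    and cl: "\<And>e. c e = Some \<alpha> \<Longrightarrow> e \<inter> S \<noteq> {} \<Longrightarrow> e \<subseteq> S"
  shows "even (card {v \<in> S. \<not> miss c v \<alpha>})"
proof -
  let ?M = "{e. c e = Some \<alpha> \<and> e \<inter> S \<noteq> {}}"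
  have "?M \<subseteq> Pow S" using cl by auto
  then have fin: "finite ?M" using assms(3) finite_subset by blast
  have eq: "{v \<in> S. \<not> miss c v \<alpha>} = \<Union> ?M" using cl by (auto simp: miss_def)
  have "finite e" if "e \<in> ?M" for e using that assms(2)[of e] by (intro card_ge_0_finite) (simp add: domI)
  moreover have "pairwise disjnt ?M"
    using assms(1) unfolding pairwise_def disjnt_def proper_map_def by blast
  ultimately have "card (\<Union> ?M) = sum card ?M" by (intro card_Union_disjoint)
  also have "\<dots> = sum (\<lambda>_. 2) ?M" using assms(2) by (intro sum.cong) auto
  finally show ?thesis unfolding eq by simp
qed

text \<open>Otherwise swapping the component of \<open>p\<close> makes \<open>\<beta>\<close>
  missing at both ends, and the last edge can be coloured.\<close>

lemma uncolored_edge_linked: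
  assumes "\<nexists>c. colors k E c" "colors k (E - {{p, q}}) c" "{p, q} \<in> E"
    and "miss c p \<alpha>" "miss c q \<beta>" "\<alpha> < k" "\<beta> < k"
  shows "q \<in> kempe_comp c \<alpha> \<beta> p"
proof (rule ccontr)
  assume *: "q \<notin> kempe_comp c \<alpha> \<beta> p"
  let ?S = "kempe_comp c \<alpha> \<beta> p"
  let ?c = "kempe_swap \<alpha> \<beta> ?S c"
  have "miss ?c p \<beta>" "miss ?c q \<beta>"
    using assms(4,5) * by (auto simp: kempe_swap_miss[OF kempe_closed_comp] kempe_comp_refl)
  then have "colors k E (?c({p, q} \<mapsto> \<beta>))"
    using assms by (intro colors_color colors_kempe_swap kempe_closed_comp) auto
  then show False using assms(1) by blast
qed

subsection \<open>Flips that fix both ends of the uncoloured edge\<close>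

text \<open>\<open>T\<close> is the complement of the chain of \<open>a\<close>. That chain has the
  two ends \<open>a\<close> and \<open>b\<close>, so no other vertex missing a colour lies on
  it.\<close>

lemma uncolored_edge_flip:
  assumes nc: "\<nexists>c. colors k E c" and c2: "\<And>e. e \<in> E \<Longrightarrow> card e = 2"
    and col: "colors k (E - {{a, b}}) f" and ab: "{a, b} \<in> E"
    and a: "miss f a \<alpha>" and b: "miss f b \<beta>" and k: "\<alpha> < k" "\<beta> < k"
  obtains T where "kempe_closed f \<alpha> \<beta> T" "a \<notin> T" "b \<notin> T"
    "\<And>x. x \<noteq> a \<Longrightarrow> x \<noteq> b \<Longrightarrow> miss f x \<alpha> \<or> miss f x \<beta> \<Longrightarrow> x \<in> T"
    "colors k (E - {{a, b}}) (kempe_swap \<alpha> \<beta> T f)"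
proof
  let ?T = "- kempe_comp f \<alpha> \<beta> a"
  show cl: "kempe_closed f \<alpha> \<beta> ?T" by (intro kempe_closed_Compl kempe_closed_comp)
  show "a \<notin> ?T" using kempe_comp_refl by simp
  have bin: "b \<in> kempe_comp f \<alpha> \<beta> a" by (rule uncolored_edge_linked[OF nc col ab a b k])
  then show "b \<notin> ?T" by simp
  have "a \<noteq> b" using c2[OF ab] by auto
  have dom: "dom f \<subseteq> E" using col unfolding colors_def by auto
  show "x \<in> ?T" if "x \<noteq> a" "x \<noteq> b" "miss f x \<alpha> \<or> miss f x \<beta>" for x
    using kempe_comp_three_ends[OF colors_proper[OF col], of a \<alpha> \<beta> b x] c2 dom a b that \<open>a \<noteq> b\<close> bin
    by auto
  show "colors k (E - {{a, b}}) (kempe_swap \<alpha> \<beta> ?T f)"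
    by (rule colors_kempe_swap[OF cl col k])
qed

text \<open>Rotation about \<open>u\<close>: the edge \<open>uq\<close> hands its colour to
  \<open>up\<close> and becomes the uncoloured edge.\<close>

lemma colors_shift:
  assumes col: "colors k (E - {{u, p}}) f" and "{u, p} \<in> E" "p \<noteq> q"
    and "f {u, q} = Some \<alpha>" "miss f p \<alpha>"
  shows "colors k (E - {{u, q}}) (f({u, q} := None, {u, p} \<mapsto> \<alpha>))"
proof (rule colors_color)
  have "E - {{u, q}} - {{u, p}} = E - {{u, p}} - {{u, q}}" by auto
  then show "colors k (E - {{u, q}} - {{u, p}}) (f({u, q} := None))"
    using colors_uncolor[OF col, of "{u, q}"] by simp
  show "{u, p} \<in> E - {{u, q}}" using assms by (auto simp: doubleton_eq_iff)
  show "miss (f({u, q} := None)) v \<alpha>" if "v \<in> {u, p}" for v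
    using that assms miss_uncolor_same[OF colors_proper[OF col], of "{u, q}" \<alpha> u] miss_uncolor[of f p \<alpha>]
    by auto
  show "\<alpha> < k" using colors_lt[OF col] assms by blast
qed

text \<open>A colouring of all edges but \<open>ab\<close> in which every colour is present at exactly one of
  \<open>a\<close> and \<open>b\<close>: what a 1-factorization becomes when a vertex is split into \<open>a\<close> and \<open>b\<close>.\<close>

locale split_state =
  fixes k :: nat and E :: "'a set set" and a b :: 'a
  assumes nc: "\<nexists>c. colors k E c" and c2: "\<And>e. e \<in> E \<Longrightarrow> card e = 2" and ab: "{a, b} \<in> E"
begin

definition state :: "('a set \<rightharpoonup> nat) \<Rightarrow> bool" where
  "state f \<longleftrightarrow> colors k (E - {{a, b}}) f \<and> (\<forall>\<theta><k. miss f a \<theta> \<longleftrightarrow> \<not> miss f b \<theta>)"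

text \<open>The flipped set avoids \<open>a\<close> and \<open>b\<close>, so the edges there keep
  their colours and \<open>state\<close> survives, while all colours at \<open>x\<close> are
  transposed.\<close>

lemma state_flip:
  assumes st: "state f" and a: "miss f a \<alpha>" and b: "miss f b \<beta>" and k: "\<alpha> < k" "\<beta> < k"
    and x: "x \<noteq> a" "x \<noteq> b" "miss f x \<alpha> \<or> miss f x \<beta>"
  obtains f' where "state f'" "\<And>v \<theta>. v = a \<or> v = b \<Longrightarrow> miss f' v \<theta> \<longleftrightarrow> miss f v \<theta>"
    "\<And>e. a \<in> e \<or> b \<in> e \<Longrightarrow> f' e = f e"
    "\<And>e. x \<in> e \<Longrightarrow> f' e = map_option (transpose \<alpha> \<beta>) (f e)"
    "\<And>\<theta>. miss f' x \<theta> \<longleftrightarrow> miss f x (transpose \<alpha> \<beta> \<theta>)"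
proof -
  have col: "colors k (E - {{a, b}}) f" using st unfolding state_def by blast
  obtain T where T: "kempe_closed f \<alpha> \<beta> T" "a \<notin> T" "b \<notin> T"
    "\<And>x. x \<noteq> a \<Longrightarrow> x \<noteq> b \<Longrightarrow> miss f x \<alpha> \<or> miss f x \<beta> \<Longrightarrow> x \<in> T"
    "colors k (E - {{a, b}}) (kempe_swap \<alpha> \<beta> T f)"
    using uncolored_edge_flip[OF nc c2 col ab a b k] by blast
  let ?f = "kempe_swap \<alpha> \<beta> T f"
  have xT: "x \<in> T" using T(4) x by blast
  show ?thesis
  proof
    show m: "miss ?f v \<theta> \<longleftrightarrow> miss f v \<theta>" if "v = a \<or> v = b" for v \<theta>
      using that T by (auto simp: kempe_swap_miss)
    show "state ?f" using st T(5) m unfolding state_def by simp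
    show "?f e = f e" if "a \<in> e \<or> b \<in> e" for e
      using that T kempe_swap_outside[OF T(1)] by blast
    show "?f e = map_option (transpose \<alpha> \<beta>) (f e)" if "x \<in> e" for e
      using kempe_swap_inside[OF that xT] .
    show "miss ?f x \<theta> \<longleftrightarrow> miss f x (transpose \<alpha> \<beta> \<theta>)" for \<theta>
      using xT by (simp add: kempe_swap_miss[OF T(1)])
  qed
qed

text \<open>If \<open>x\<close> and \<open>b\<close> miss a common colour, then \<open>bx\<close>
  hands its colour to \<open>ab\<close> and takes the common one. Otherwise a flip first turns the
  colour missing at \<open>x\<close> into one missing at \<open>b\<close>.\<close>

lemma state_deficient_neighbor:
  assumes st: "state f" and x: "x \<noteq> a" "x \<noteq> b" and \<eta>: "miss f x \<eta>" "\<eta> < k"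
    and bx: "f {b, x} = Some \<gamma>" and \<epsilon>: "miss f b \<epsilon>" "\<epsilon> < k"
  shows False
proof -
  have main: False if st: "state f" and \<eta>: "miss f x \<eta>" "miss f b \<eta>" "\<eta> < k" and bx: "f {b, x} = Some \<gamma>" for f \<eta>
  proof -
    have col: "colors k (E - {{b, a}}) f" using st unfolding state_def by (simp add: insert_commute)
    have \<gamma>: "miss f a \<gamma>" using st bx colors_lt[OF col bx] not_missI[of f "{b, x}" \<gamma> b]
      unfolding state_def by auto
    have "colors k (E - {{b, x}}) (f({b, x} := None, {b, a} \<mapsto> \<gamma>))"
      by (rule colors_shift[OF col _ _ bx \<gamma>]) (use ab x in \<open>auto simp: insert_commute\<close>)
    then have "colors k E (f({b, x} := None, {b, a} \<mapsto> \<gamma>, {b, x} \<mapsto> \<eta>))"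
    proof (rule colors_color)
      show "{b, x} \<in> E" using col bx unfolding colors_def by auto
      have "\<eta> \<noteq> \<gamma>" using \<eta>(2) not_missI[of f "{b, x}" \<gamma> b] bx by auto
      then show "miss (f({b, x} := None, {b, a} \<mapsto> \<gamma>)) v \<eta>" if "v \<in> {b, x}" for v
        using that \<eta> by (intro miss_upd miss_uncolor) auto
    qed (rule \<eta>(3))
    then show False using nc by blast
  qed
  show False
  proof (cases "miss f b \<eta>")
    case True
    then show False using main[OF st] \<eta> bx by blast
  next
    case False
    then have "miss f a \<eta>" using st \<eta> unfolding state_def by blast
    with st obtain f' where "state f'" "\<And>v \<theta>. v = a \<or> v = b \<Longrightarrow> miss f' v \<theta> \<longleftrightarrow> miss f v \<theta>"
      "\<And>e. a \<in> e \<or> b \<in> e \<Longrightarrow> f' e = f e" "\<And>\<theta>. miss f' x \<theta> \<longleftrightarrow> miss f x (transpose \<eta> \<epsilon> \<theta>)"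
      by (rule state_flip[OF _ _ \<epsilon>(1) \<eta>(2) \<epsilon>(2) x]) (use \<eta> in blast)+
    then show False using main[of f' \<epsilon>] \<epsilon> \<eta> bx by simp
  qed
qed

text \<open>The flips below move the colour missing at \<open>x\<close> to the colour of \<open>bu\<close>
  while bringing the colour of \<open>ux\<close> into the colours missing at \<open>b\<close>.\<close>

lemma state_deficient_distance_two:
  assumes st: "state f" and x: "x \<noteq> a" "x \<noteq> b" and u: "u \<noteq> a" "u \<noteq> b" "u \<noteq> x"
    and \<eta>: "miss f x \<eta>" "\<eta> < k" and bu: "f {b, u} = Some \<gamma>" and ux: "f {u, x} = Some \<delta>"
    and \<epsilon>: "miss f b \<epsilon>1" "miss f b \<epsilon>2" "\<epsilon>1 \<noteq> \<epsilon>2" "\<epsilon>1 < k" "\<epsilon>2 < k"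
  shows False
proof -
  \<comment> \<open>Here the recolouring is direct: \<open>ab\<close> takes \<open>\<gamma>\<close>
    from \<open>bu\<close>, \<open>bu\<close> takes \<open>\<delta>\<close> from \<open>ux\<close>,
    and \<open>ux\<close> takes \<open>\<gamma>\<close>, by then missing at \<open>u\<close> and
    \<open>x\<close>.\<close>
  have 1: False if st: "state f" and \<gamma>: "miss f x \<gamma>" and bu: "f {b, u} = Some \<gamma>"
    and ux: "f {u, x} = Some \<delta>" and \<delta>: "miss f b \<delta>" for f \<delta>
  proof -
    have col: "colors k (E - {{b, a}}) f" using st unfolding state_def by (simp add: insert_commute)
    have \<gamma>k: "\<gamma> < k" using colors_lt[OF col bu] .
    have a\<gamma>: "miss f a \<gamma>" using st bu \<gamma>k not_missI[of f "{b, u}" \<gamma> b]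
      unfolding state_def by auto
    have \<delta>\<gamma>: "\<delta> \<noteq> \<gamma>" using \<delta> not_missI[of f "{b, u}" \<gamma> b] bu by auto
    have inE: "{u, b} \<in> E" "{u, x} \<in> E"
      using col bu ux unfolding colors_def by (auto simp: insert_commute)
    define f1 where "f1 = f({b, u} := None, {b, a} \<mapsto> \<gamma>)"
    have "colors k (E - {{b, u}}) f1"
      unfolding f1_def by (rule colors_shift[OF col _ _ bu a\<gamma>]) (use ab u in \<open>auto simp: insert_commute\<close>)
    then have col1: "colors k (E - {{u, b}}) f1" by (simp add: insert_commute)
    have ux1: "f1 {u, x} = Some \<delta>" using ux x u unfolding f1_def by (auto simp: doubleton_eq_iff)
    have b1: "miss f1 b \<delta>" unfolding f1_def using \<delta> \<delta>\<gamma> by (intro miss_upd miss_uncolor) auto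
    have x1: "miss f1 x \<gamma>" unfolding f1_def using \<gamma> x by (intro miss_upd miss_uncolor) auto
    have u1: "miss f1 u \<gamma>" unfolding f1_def using u bu colors_proper[OF col]
      by (intro miss_upd miss_uncolor_same) auto
    define f2 where "f2 = f1({u, x} := None, {u, b} \<mapsto> \<delta>)"
    have col2: "colors k (E - {{u, x}}) f2"
      unfolding f2_def by (rule colors_shift[OF col1 _ _ ux1 b1]) (use inE x in auto)
    have "miss f2 v \<gamma>" if "v \<in> {u, x}" for v
      unfolding f2_def using that u1 x1 \<delta>\<gamma> by (intro miss_upd miss_uncolor) auto
    then have "colors k E (f2({u, x} \<mapsto> \<gamma>))"
      by (rule colors_color[OF col2 inE(2) _ \<gamma>k])
    then show False using nc by blast
  qed
  have b\<gamma>: "miss f a \<gamma> \<and> \<not> miss f b \<gamma> \<and> \<gamma> < k" if "state f" "f {b, u} = Some \<gamma>" for f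
    using that not_missI[of f "{b, u}" \<gamma> b] colors_lt[of k _ f] unfolding state_def by blast
  \<comment> \<open>Flipping \<open>\<gamma>\<close> and \<open>\<eta>\<close> makes
    \<open>x\<close> miss \<open>\<gamma>\<close>; since \<open>\<delta>\<close> differs from both,
    \<open>ux\<close> keeps it.\<close>
  have 2: False if st: "state f" and \<eta>: "miss f x \<eta>" "\<eta> < k" "miss f b \<eta>" and bu: "f {b, u} = Some \<gamma>"
    and ux: "f {u, x} = Some \<delta>" and \<delta>: "miss f b \<delta>" for f \<eta> \<delta>
  proof -
    have ne: "\<delta> \<noteq> \<eta>" "\<delta> \<noteq> \<gamma>" using b\<gamma>[OF st bu] \<eta> \<delta> not_missI[of f "{u, x}" \<delta> x] ux by auto
    from st obtain f' where "state f'" "\<And>v \<theta>. v = a \<or> v = b \<Longrightarrow> miss f' v \<theta> \<longleftrightarrow> miss f v \<theta>"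
      "\<And>e. a \<in> e \<or> b \<in> e \<Longrightarrow> f' e = f e" "\<And>\<theta>. miss f' x \<theta> \<longleftrightarrow> miss f x (transpose \<gamma> \<eta> \<theta>)"
      "\<And>e. x \<in> e \<Longrightarrow> f' e = map_option (transpose \<gamma> \<eta>) (f e)"
      by (rule state_flip[OF _ _ \<eta>(3) _ \<eta>(2) x]) (use \<eta> b\<gamma>[OF st bu] in blast)+
    then show False using 1[of f' \<delta>] \<eta> \<delta> bu ux ne by simp
  qed
  \<comment> \<open>If \<open>b\<close> sees \<open>\<eta>\<close>, flipping \<open>\<eta>\<close>
    and \<open>\<epsilon>\<close> makes \<open>x\<close> miss a colour that \<open>b\<close> misses;
    \<open>ux\<close> keeps \<open>\<delta>\<close> because \<open>\<epsilon>\<close> differs from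
    it.\<close>
  have 3: False if st: "state f" and \<eta>: "miss f x \<eta>" "\<eta> < k" and bu: "f {b, u} = Some \<gamma>"
    and ux: "f {u, x} = Some \<delta>" and \<delta>: "miss f b \<delta>" and \<epsilon>: "miss f b \<epsilon>" "\<epsilon> \<noteq> \<delta>" "\<epsilon> < k" for f \<eta> \<delta> \<epsilon>
  proof (cases "miss f b \<eta>")
    case True
    then show False using 2[OF st \<eta>] bu ux \<delta> by blast
  next
    case False
    then have a: "miss f a \<eta>" using st \<eta> unfolding state_def by blast
    have ne: "\<delta> \<noteq> \<eta>" using \<eta> not_missI[of f "{u, x}" \<delta> x] ux by auto
    from st obtain f' where "state f'" "\<And>v \<theta>. v = a \<or> v = b \<Longrightarrow> miss f' v \<theta> \<longleftrightarrow> miss f v \<theta>"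
      "\<And>e. a \<in> e \<or> b \<in> e \<Longrightarrow> f' e = f e" "\<And>\<theta>. miss f' x \<theta> \<longleftrightarrow> miss f x (transpose \<eta> \<epsilon> \<theta>)"
      "\<And>e. x \<in> e \<Longrightarrow> f' e = map_option (transpose \<eta> \<epsilon>) (f e)"
      by (rule state_flip[OF _ a \<epsilon>(1) \<eta>(2) \<epsilon>(3) x]) (use \<eta> in blast)+
    then show False using 2[of f' \<epsilon> \<delta>] \<eta> \<delta> bu ux ne \<epsilon> by simp
  qed
  \<comment> \<open>If \<open>b\<close> sees \<open>\<delta>\<close>, flipping
    \<open>\<delta>\<close> and \<open>\<eta>\<close> gives \<open>ux\<close> the colour
    \<open>\<eta>\<close>, which \<open>b\<close> misses, and makes \<open>x\<close> miss
    \<open>\<delta>\<close>.\<close>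
  have 4: False if st: "state f" and \<eta>: "miss f x \<eta>" "\<eta> < k" "miss f b \<eta>" and bu: "f {b, u} = Some \<gamma>"
    and ux: "f {u, x} = Some \<delta>" and \<epsilon>: "miss f b \<epsilon>" "\<epsilon> \<noteq> \<eta>" "\<epsilon> < k" for f \<eta> \<delta> \<epsilon>
  proof (cases "miss f b \<delta>")
    case True
    then show False using 2[OF st \<eta>] bu ux by blast
  next
    case False
    have \<delta>k: "\<delta> < k" using st ux colors_lt unfolding state_def by blast
    then have a: "miss f a \<delta>" using st False unfolding state_def by blast
    from st obtain f' where "state f'" "\<And>v \<theta>. v = a \<or> v = b \<Longrightarrow> miss f' v \<theta> \<longleftrightarrow> miss f v \<theta>"
      "\<And>e. a \<in> e \<or> b \<in> e \<Longrightarrow> f' e = f e" "\<And>\<theta>. miss f' x \<theta> \<longleftrightarrow> miss f x (transpose \<delta> \<eta> \<theta>)"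
      "\<And>e. x \<in> e \<Longrightarrow> f' e = map_option (transpose \<delta> \<eta>) (f e)"
      by (rule state_flip[OF _ a \<eta>(3) \<delta>k \<eta>(2) x]) (use \<eta> in blast)+
    then show False using 3[of f' \<delta> \<eta> \<epsilon>] \<eta> \<delta>k bu ux \<epsilon> by simp
  qed
  \<comment> \<open>One of the two colours missing at \<open>b\<close> differs from the colour of
    \<open>ux\<close>, so a flip with it leaves \<open>ux\<close> alone.\<close>
  obtain \<epsilon> where e: "miss f b \<epsilon>" "\<epsilon> < k" "\<epsilon> \<noteq> \<delta>" using \<epsilon> by metis
  show False
  proof (cases "miss f b \<eta>")
    case True
    then show False using 4[OF st \<eta>] bu ux \<epsilon> by metis
  next
    case False
    then have a: "miss f a \<eta>" using st \<eta> unfolding state_def by blast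
    have ne: "\<delta> \<noteq> \<eta>" using \<eta> not_missI[of f "{u, x}" \<delta> x] ux by auto
    obtain \<epsilon>' where e': "miss f b \<epsilon>'" "\<epsilon>' < k" "\<epsilon>' \<noteq> \<epsilon>" using \<epsilon> by metis
    from st obtain f' where "state f'" "\<And>v \<theta>. v = a \<or> v = b \<Longrightarrow> miss f' v \<theta> \<longleftrightarrow> miss f v \<theta>"
      "\<And>e. a \<in> e \<or> b \<in> e \<Longrightarrow> f' e = f e" "\<And>\<theta>. miss f' x \<theta> \<longleftrightarrow> miss f x (transpose \<eta> \<epsilon> \<theta>)"
      "\<And>e. x \<in> e \<Longrightarrow> f' e = map_option (transpose \<eta> \<epsilon>) (f e)"
      by (rule state_flip[OF _ a e(1) \<eta>(2) e(2) x]) (use \<eta> in blast)+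
    then show False using 4[of f' \<epsilon> \<delta> \<epsilon>'] \<eta> bu ux ne e e' by simp
  qed
qed

end

subsection \<open>Kites\<close>

context
  fixes k :: nat and E :: "'a set set" and V :: "'a set"
  assumes nc: "\<nexists>c. colors k E c" and EV: "\<And>e. e \<in> E \<Longrightarrow> card e = 2 \<and> e \<subseteq> V" and finV: "finite V"
begin

text \<open>Two routes through \<open>b\<close> move the uncoloured edge to \<open>wx\<close> or to
  \<open>wy\<close>. That they cannot both succeed keeps \<open>b\<close> and \<open>x\<close> off
  the chain \<open>S\<close>, and parity then puts \<open>a\<close> on it.\<close>

lemma kite_step:
  assumes col: "colors k (E - {{a, b}}) f" and ab: "{a, b} \<in> E" and V: "w \<in> V"
    and dist: "distinct [a, b, w, x, y]"
    and b: "miss f b \<pi>" and a: "\<And>\<theta>. \<theta> < k \<Longrightarrow> miss f a \<theta> \<longleftrightarrow> \<theta> \<noteq> \<pi>"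
    and xy: "miss f x \<delta>" "miss f y \<delta>" "\<delta> < k"
    and full: "\<And>v \<theta>. v \<in> V \<Longrightarrow> \<theta> < k \<Longrightarrow> miss f v \<theta> \<Longrightarrow>
        v = a \<or> (v = b \<and> \<theta> = \<pi>) \<or> ((v = x \<or> v = y) \<and> \<theta> = \<delta>)"
    and bw: "f {b, w} = Some \<gamma>" and wx: "f {w, x} = Some \<pi>" and wy: "f {w, y} = Some \<delta>'"
  defines "S \<equiv> kempe_comp (f({w, x} := None)) \<pi> \<delta>' w"
  shows "a \<in> S \<and> b \<notin> S"
proof -
  let ?ab = "{a, b}" and ?bw = "{b, w}" and ?wx = "{w, x}" and ?wy = "{w, y}"
  have pr: "proper_map f" using col by (rule colors_proper)
  have dom: "dom f = E - {?ab}" using col unfolding colors_def by blast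
  have fab: "f ?ab = None" by (rule colors_None[OF col]) simp
  have inE: "?bw \<in> E" "?wx \<in> E" "?wy \<in> E" "?ab \<in> E" using ab domI[of f, OF bw] domI[of f, OF wx] domI[of f, OF wy] unfolding dom by simp_all
  have ne: "?ab \<noteq> ?bw" "?ab \<noteq> ?wx" "?ab \<noteq> ?wy" "?bw \<noteq> ?wx" "?bw \<noteq> ?wy" "?wx \<noteq> ?wy"
    using dist by (auto simp: doubleton_eq_iff)
  have k: "\<gamma> < k" "\<pi> < k" "\<delta>' < k" using colors_lt[OF col bw] colors_lt[OF col wx] colors_lt[OF col wy] .
  have "\<gamma> \<noteq> \<pi>" using proper_map_inj[OF pr bw, of ?wx w] wx ne by blast
  moreover have "\<gamma> \<noteq> \<delta>'" using proper_map_inj[OF pr bw, of ?wy w] wy ne by blast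
  moreover have "\<pi> \<noteq> \<delta>'" using proper_map_inj[OF pr wx, of ?wy w] wy ne by blast
  moreover have "\<delta> \<noteq> \<pi>" using not_missI[of f, OF wx, of x] xy by blast
  moreover have "\<delta> \<noteq> \<delta>'" using not_missI[of f, OF wy, of y] xy by blast
  ultimately have cne: "\<gamma> \<noteq> \<pi>" "\<gamma> \<noteq> \<delta>'" "\<pi> \<noteq> \<delta>'" "\<delta> \<noteq> \<pi>" "\<delta> \<noteq> \<delta>'" by blast+
  \<comment> \<open>Common stage of both routes: \<open>ab\<close> has taken \<open>\<gamma>\<close>
    from \<open>bw\<close>, and both \<open>bw\<close> and \<open>wx\<close> are still open.\<close>
  define g where "g = f(?wx := None, ?bw := None, ?ab \<mapsto> \<gamma>)"
  have colg: "colors k (E - {?bw, ?wx}) g"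
    unfolding g_def
  proof (rule colors_color)
    have "E - {?bw, ?wx} - {?ab} = E - {?ab} - {?wx} - {?bw}" by auto
    then show "colors k (E - {?bw, ?wx} - {?ab}) (f(?wx := None, ?bw := None))"
      using colors_uncolor[OF colors_uncolor[OF col]] by simp
    show "?ab \<in> E - {?bw, ?wx}" using inE ne by auto
    fix v assume "v \<in> ?ab"
    then show "miss (f(?wx := None, ?bw := None)) v \<gamma>"
      using a[of \<gamma>] k cne bw ne miss_uncolor[OF miss_uncolor, of f a \<gamma> ?wx ?bw]
        miss_uncolor_same[OF proper_map_uncolor[OF pr], of ?wx ?bw \<gamma> b] by auto
  qed (rule k)
  have prg: "proper_map g" using colg by (rule colors_proper)
  have c2g: "card e = 2" if "e \<in> dom g" for e using that colg EV unfolding colors_def by auto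
  have mw\<gamma>: "miss g w \<gamma>"
    unfolding g_def using dist bw ne
    by (intro miss_upd miss_uncolor_same proper_map_uncolor pr) auto
  have mw\<pi>: "miss g w \<pi>"
    unfolding g_def using dist wx
    by (intro miss_upd miss_uncolor miss_uncolor_same pr) auto
  note mw = mw\<gamma> mw\<pi>
  have mb: "miss g b \<pi>" unfolding g_def using b cne by (intro miss_upd miss_uncolor) auto
  have mx\<pi>: "miss g x \<pi>"
    unfolding g_def using dist wx
    by (intro miss_upd miss_uncolor miss_uncolor_same pr) auto
  have mx\<delta>: "miss g x \<delta>" and my: "miss g y \<delta>"
    unfolding g_def using dist xy by (auto intro!: miss_upd miss_uncolor)
  note mx = mx\<pi> mx\<delta>
  have gwy: "g ?wy = Some \<delta>'" using wy ne unfolding g_def by auto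
  \<comment> \<open>Colouring \<open>bw\<close> with \<open>\<pi>\<close> links \<open>w\<close> to \<open>x\<close>, so by the endpoint count never to \<open>y\<close>.\<close>
  have "x \<in> kempe_comp (g(?bw \<mapsto> \<pi>)) \<gamma> \<delta> w"
  proof (rule uncolored_edge_linked[OF nc])
    show "colors k (E - {?wx}) (g(?bw \<mapsto> \<pi>))"
    proof (rule colors_color)
      have "E - {?wx} - {?bw} = E - {?bw, ?wx}" by auto
      then show "colors k (E - {?wx} - {?bw}) g" using colg by simp
      show "?bw \<in> E - {?wx}" using inE ne by auto
    qed (use mw mb k in auto)
  qed (use inE mw mx k xy cne dist in \<open>auto intro!: miss_upd\<close>)
  also have "kempe_comp (g(?bw \<mapsto> \<pi>)) \<gamma> \<delta> w = kempe_comp g \<gamma> \<delta> w"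
    by (rule kempe_comp_cong) (use cne ne in \<open>auto simp: g_def\<close>)
  finally have y_notin: "y \<notin> kempe_comp g \<gamma> \<delta> w"
    using kempe_comp_three_ends[OF prg c2g, of w \<gamma> \<delta> x y] mw mx my dist by auto
  \<comment> \<open>If only \<open>wy\<close> were uncoloured and the edges in
    \<open>\<gamma>\<close> and \<open>\<delta>\<close> were those of \<open>g\<close>, then
    \<open>w\<close> and \<open>y\<close> would be linked, against \<open>y_notin\<close>.\<close>
  have contra: False if colh: "colors k (E - {?wy}) h"
    and h: "\<And>e. h e = Some \<gamma> \<or> h e = Some \<delta> \<longleftrightarrow> g e = Some \<gamma> \<or> g e = Some \<delta>"
    and m: "miss h w \<gamma>" "miss h y \<delta>" for h
    using uncolored_edge_linked[OF nc colh inE(3) m k(1) xy(3)] kempe_comp_cong[of h \<gamma> \<delta> g w, OF h]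
      y_notin by simp
  have miss_gd: "miss h w \<gamma> \<and> miss h y \<delta>"
    if "\<And>e. h e = Some \<gamma> \<longleftrightarrow> g e = Some \<gamma>" "\<And>e. h e = Some \<delta> \<longleftrightarrow> g e = Some \<delta>" for h
    using that mw my unfolding miss_def by blast
  \<comment> \<open>Apart from \<open>wx\<close>, passing from \<open>f\<close> to \<open>g\<close>
    only moves \<open>\<gamma>\<close> from \<open>bw\<close> to \<open>ab\<close>.\<close>
  have S: "S = kempe_comp g \<pi> \<delta>' w"
    unfolding S_def by (rule kempe_comp_cong) (use cne bw fab in \<open>simp add: g_def\<close>)
  \<comment> \<open>After this swap \<open>wy\<close> has colour \<open>\<pi>\<close> and
    \<open>w\<close> misses \<open>\<delta>'\<close>. Uncolouring \<open>wy\<close> thus frees both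
    colours at \<open>w\<close> for the open edges \<open>bw\<close> and \<open>wx\<close>; which
    edge gets which depends on the position of \<open>b\<close> and \<open>x\<close>.\<close>
  define g' where "g' = kempe_swap \<pi> \<delta>' S g"
  have cl: "kempe_closed g \<pi> \<delta>' S" unfolding S by (rule kempe_closed_comp)
  have wS: "w \<in> S" unfolding S by (rule kempe_comp_refl)
  have colg': "colors k (E - {?bw, ?wx}) g'"
    unfolding g'_def by (rule colors_kempe_swap[OF cl colg k(2,3)])
  have prg': "proper_map g'" using colg' by (rule colors_proper)
  have g'wy: "g' ?wy = Some \<pi>" unfolding g'_def using gwy wS kempe_swap_inside[of w ?wy S \<pi> \<delta>' g] by simp
  have m': "miss g' v \<theta> \<longleftrightarrow> miss g v (if v \<in> S then transpose \<pi> \<delta>' \<theta> else \<theta>)" for v \<theta>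
    unfolding g'_def by (rule kempe_swap_miss[OF cl])
  have g'_other: "g' e = Some \<theta> \<longleftrightarrow> g e = Some \<theta>" if "\<theta> \<noteq> \<pi>" "\<theta> \<noteq> \<delta>'" for e \<theta>
    unfolding g'_def using kempe_swap_other[OF that] .
  have g_None: "g ?bw = None" "g ?wx = None"
    by (rule colors_None[OF colg], simp)+
  have g'_None: "g' ?bw = None" "g' ?wx = None"
    by (rule colors_None[OF colg'], simp)+
  have wm: "miss g' w \<delta>'" using m' wS mw by simp
  \<comment> \<open>With \<open>b\<close> on the chain, \<open>x\<close> is off it, since
    \<open>w\<close>, \<open>b\<close> and \<open>x\<close> all miss \<open>\<pi>\<close>. After the
    swap \<open>bw\<close> can take \<open>\<delta>'\<close> and \<open>wx\<close> can take
    \<open>\<pi>\<close>.\<close>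
  have bS: "b \<notin> S"
  proof
    assume bS: "b \<in> S"
    then have xS: "x \<notin> S"
      using kempe_comp_three_ends[OF prg c2g, of w \<pi> \<delta>' b x] mw mb mx dist unfolding S by auto
    define h where "h = g'(?wy := None, ?wx \<mapsto> \<pi>, ?bw \<mapsto> \<delta>')"
    have "colors k (E - {?wy}) h"
      unfolding h_def
    proof (rule colors_color[OF colors_color])
      have "E - {?wy} - {?bw} - {?wx} = E - {?bw, ?wx} - {?wy}" by auto
      then show "colors k (E - {?wy} - {?bw} - {?wx}) (g'(?wy := None))"
        using colors_uncolor[OF colg'] by simp
      show "?wx \<in> E - {?wy} - {?bw}" "?bw \<in> E - {?wy}" using inE ne by auto
      show "miss (g'(?wy := None)) v \<pi>" if "v \<in> ?wx" for v
        using that xS m' mx g'wy by (auto intro: miss_uncolor_same[OF prg'] miss_uncolor)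
      show "miss (g'(?wy := None, ?wx \<mapsto> \<pi>)) v \<delta>'" if "v \<in> ?bw" for v
        using that wm m' mb bS cne by (auto intro!: miss_upd intro: miss_uncolor)
    qed (use k in auto)
    moreover have "h e = Some \<theta> \<longleftrightarrow> g e = Some \<theta>" if "\<theta> = \<gamma> \<or> \<theta> = \<delta>" for e \<theta>
    proof -
      have \<theta>: "\<theta> \<noteq> \<pi>" "\<theta> \<noteq> \<delta>'" using that cne by auto
      then have "h e = Some \<theta> \<longleftrightarrow> g' e = Some \<theta>"
        using g'_None g'wy unfolding h_def by simp
      then show ?thesis using g'_other[OF \<theta>] by simp
    qed
    ultimately show False using contra[of h] miss_gd[of h] by blast
  qed
  \<comment> \<open>Now \<open>b\<close> still misses \<open>\<pi>\<close> and \<open>x\<close>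
    would miss \<open>\<delta>'\<close> after the swap, so the roles of the two colours are
    exchanged.\<close>
  have xS: "x \<notin> S"
  proof
    assume xS: "x \<in> S"
    define h where "h = g'(?wy := None, ?wx \<mapsto> \<delta>', ?bw \<mapsto> \<pi>)"
    have "colors k (E - {?wy}) h"
      unfolding h_def
    proof (rule colors_color[OF colors_color])
      have "E - {?wy} - {?bw} - {?wx} = E - {?bw, ?wx} - {?wy}" by auto
      then show "colors k (E - {?wy} - {?bw} - {?wx}) (g'(?wy := None))"
        using colors_uncolor[OF colg'] by simp
      show "?wx \<in> E - {?wy} - {?bw}" "?bw \<in> E - {?wy}" using inE ne by auto
      show "miss (g'(?wy := None)) v \<delta>'" if "v \<in> ?wx" for v
        using that xS m' mx wm by (auto intro: miss_uncolor)
      show "miss (g'(?wy := None, ?wx \<mapsto> \<delta>')) v \<pi>" if "v \<in> ?bw" for v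
        using that m' mb bS cne g'wy
        by (auto intro!: miss_upd intro: miss_uncolor_same[OF prg'] miss_uncolor)
    qed (use k in auto)
    moreover have "h e = Some \<theta> \<longleftrightarrow> g e = Some \<theta>" if "\<theta> = \<gamma> \<or> \<theta> = \<delta>" for e \<theta>
    proof -
      have \<theta>: "\<theta> \<noteq> \<pi>" "\<theta> \<noteq> \<delta>'" using that cne by auto
      then have "h e = Some \<theta> \<longleftrightarrow> g' e = Some \<theta>"
        using g'_None g'wy unfolding h_def by simp
      then show ?thesis using g'_other[OF \<theta>] by simp
    qed
    ultimately show False using contra[of h] miss_gd[of h] by blast
  qed
  \<comment> \<open>Were \<open>a\<close> off the chain as well, \<open>\<delta>'\<close> would be
    present at all vertices of \<open>S\<close> and \<open>\<pi>\<close> at all but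
    \<open>w\<close>, yet both numbers are even.\<close>
  have "a \<in> S"
  proof (rule ccontr)
    assume aS: "a \<notin> S"
    have "kempe_closed g \<pi> \<delta>' V"
      using colg EV unfolding kempe_closed_def colors_def by blast
    then have SV: "S \<subseteq> V" unfolding S by (rule kempe_comp_least[OF _ V])
    then have finS: "finite S" using finV finite_subset by blast
    have even: "even (card {v \<in> S. \<not> miss g v \<theta>})" if "\<theta> = \<pi> \<or> \<theta> = \<delta>'" for \<theta>
      by (rule even_card_saturated[OF prg _ finS])
        (use c2g kempe_closedD[OF cl] that in \<open>blast+\<close>)
    have fm: "miss f v \<theta>" if "miss g v \<theta>" "v \<noteq> a" "v \<noteq> b" "\<theta> = \<pi> \<or> \<theta> = \<delta>'" "v \<noteq> w \<or> \<theta> = \<delta>'" "v \<noteq> x" for v \<theta>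
      unfolding miss_def
    proof (intro allI impI notI)
      fix e assume "v \<in> e" and fe: "f e = Some \<theta>"
      have "e \<noteq> ?ab" using fe fab by auto
      moreover have "e \<noteq> ?bw" using fe bw that(4) cne by auto
      moreover have "e \<noteq> ?wx" using fe wx that(5,6) \<open>v \<in> e\<close> cne by auto
      ultimately have "g e = Some \<theta>" using fe unfolding g_def by simp
      then show False using that(1) \<open>v \<in> e\<close> unfolding miss_def by blast
    qed
    have "{v \<in> S. \<not> miss g v \<delta>'} = S"
    proof -
      have "\<not> miss g v \<delta>'" if "v \<in> S" for v
        using fm[of v \<delta>'] full[of v \<delta>'] that SV aS bS xS k cne by blast
      then show ?thesis by blast
    qed
    moreover have "{v \<in> S. \<not> miss g v \<pi>} = S - {w}"
    proof -
      have "\<not> miss g v \<pi>" if "v \<in> S" "v \<noteq> w" for v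
        using fm[of v \<pi>] full[of v \<pi>] that SV aS bS xS k cne by blast
      then show ?thesis using mw by blast
    qed
    ultimately have "even (card S)" "even (card (S - {w}))" using even[of \<delta>'] even[of \<pi>] by simp_all
    then show False using wS finS by (metis card_Suc_Diff1 even_Suc)
  qed
  then show ?thesis using bS by blast
qed

text \<open>\<open>kite_step\<close> is applied with \<open>b\<close> and, after moving the
  uncoloured edge from \<open>ab\<close> to \<open>ac\<close>, with \<open>c\<close>. In
  \<open>f\<close> the chain of \<open>w\<close> reaches \<open>a\<close>, which is possible only
  along \<open>ac\<close>; in \<open>h\<close> the chain avoids \<open>c\<close>. As
  \<open>f\<close> and \<open>h\<close> differ only on \<open>ab\<close> and \<open>ac\<close>, this
  is contradictory.\<close>

lemma kite_reduced:
  assumes col: "colors k (E - {{a, b}}) f" and ab: "{a, b} \<in> E" and V: "w \<in> V"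
    and dist: "distinct [a, b, c, w, x, y]" and ac: "f {a, c} = Some \<pi>"
    and b: "miss f b \<pi>" and a: "\<And>\<theta>. \<theta> < k \<Longrightarrow> miss f a \<theta> \<longleftrightarrow> \<theta> \<noteq> \<pi>"
    and xy: "miss f x \<delta>" "miss f y \<delta>" "\<delta> < k"
    and full: "\<And>v \<theta>. v \<in> V \<Longrightarrow> \<theta> < k \<Longrightarrow> miss f v \<theta> \<Longrightarrow>
        v = a \<or> (v = b \<and> \<theta> = \<pi>) \<or> ((v = x \<or> v = y) \<and> \<theta> = \<delta>)"
    and bw: "f {b, w} = Some \<gamma>" and cw: "f {c, w} = Some \<kappa>"
    and wx: "f {w, x} = Some \<pi>" and wy: "f {w, y} = Some \<delta>'"
  shows False
proof -
  have pr: "proper_map f" using col by (rule colors_proper)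
  have fab: "f {a, b} = None" by (rule colors_None[OF col]) simp
  have k: "\<pi> < k" "\<delta>' < k" using colors_lt[OF col wx] colors_lt[OF col wy] .
  have ne: "\<pi> \<noteq> \<delta>'"
    using proper_map_inj[OF pr wx, of "{w, y}" w] wy dist by (auto simp: doubleton_eq_iff)
  have edge_ne: "{a, b} \<noteq> {a, c}" "{w, x} \<noteq> {a, c}" "{w, x} \<noteq> {a, b}" "{w, y} \<noteq> {a, c}"
    "{w, y} \<noteq> {a, b}" "{c, w} \<noteq> {a, c}" "{c, w} \<noteq> {a, b}"
    using dist by (auto simp: doubleton_eq_iff)
  define h where "h = f({a, c} := None, {a, b} \<mapsto> \<pi>)"
  have colh: "colors k (E - {{a, c}}) h"
    unfolding h_def by (rule colors_shift[OF col ab _ ac b]) (use dist in auto)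
  have "distinct [a, b, w, x, y]" using dist by auto
  then have g: "a \<in> kempe_comp (f({w, x} := None)) \<pi> \<delta>' w"
    using kite_step[OF col ab V _ b a xy full bw wx wy] by blast
  have acE: "{a, c} \<in> E" using col ac unfolding colors_def by auto
  have "c \<notin> kempe_comp (h({w, x} := None)) \<pi> \<delta>' w \<and> a \<in> kempe_comp (h({w, x} := None)) \<pi> \<delta>' w"
  proof -
    have d: "distinct [a, c, w, x, y]" using dist by auto
    have c: "miss h c \<pi>" unfolding h_def using dist ac by (intro miss_upd miss_uncolor_same pr) auto
    have a': "miss h a \<theta> \<longleftrightarrow> \<theta> \<noteq> \<pi>" if "\<theta> < k" for \<theta>
    proof
      assume "miss h a \<theta>"
      moreover have "h {a, b} = Some \<pi>" unfolding h_def by simp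
      ultimately show "\<theta> \<noteq> \<pi>" unfolding miss_def by blast
    next
      assume "\<theta> \<noteq> \<pi>"
      then show "miss h a \<theta>" unfolding h_def using a[OF that] by (intro miss_upd miss_uncolor) auto
    qed
    have xy': "miss h x \<delta>" "miss h y \<delta>"
      unfolding h_def using xy dist by (auto intro!: miss_upd miss_uncolor)
    have full': "p = a \<or> (p = c \<and> \<theta> = \<pi>) \<or> ((p = x \<or> p = y) \<and> \<theta> = \<delta>)"
      if "p \<in> V" "\<theta> < k" "miss h p \<theta>" for p \<theta>
    proof (rule ccontr)
      assume *: "\<not> ?thesis"
      have "miss f p \<theta>"
        unfolding miss_def
      proof (intro allI impI notI)
        fix e assume "p \<in> e" and fe: "f e = Some \<theta>"
        have "e \<noteq> {a, b}" using fe fab by auto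
        moreover have "e \<noteq> {a, c}" using * \<open>p \<in> e\<close> fe ac by auto
        ultimately have "h e = Some \<theta>" using fe unfolding h_def by simp
        then show False using that(3) \<open>p \<in> e\<close> unfolding miss_def by blast
      qed
      then have "p = b" "\<theta> = \<pi>" using full[OF that(1,2)] * by auto
      moreover have "h {a, b} = Some \<pi>" unfolding h_def by simp
      ultimately show False using that(3) unfolding miss_def by blast
    qed
    have "h {c, w} = Some \<kappa>" "h {w, x} = Some \<pi>" "h {w, y} = Some \<delta>'"
      unfolding h_def using cw wx wy edge_ne by auto
    then show ?thesis
      using kite_step[OF colh acE V d c a' xy' xy(3) full'] by blast
  qed
  then have h: "c \<notin> kempe_comp (h({w, x} := None)) \<pi> \<delta>' w" by blast
  \<comment> \<open>Under \<open>f\<close> the only edge at \<open>a\<close> in the two colours is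
    \<open>ac\<close>. As \<open>c\<close> is not in the component, removing \<open>a\<close> leaves
    a set closed for \<open>f\<close>.\<close>
  let ?T = "kempe_comp (h({w, x} := None)) \<pi> \<delta>' w - {a}"
  have "kempe_closed (f({w, x} := None)) \<pi> \<delta>' ?T"
    unfolding kempe_closed_def
  proof (intro allI impI)
    fix e assume e: "(f({w, x} := None)) e = Some \<pi> \<or> (f({w, x} := None)) e = Some \<delta>'" "e \<inter> ?T \<noteq> {}"
    then have fe: "f e = Some \<pi> \<or> f e = Some \<delta>'" "e \<noteq> {w, x}" by (auto split: if_splits)
    have eac: "e \<noteq> {a, c}" using e(2) h by auto
    have "e \<noteq> {a, b}" using fe fab by auto
    have "a \<notin> e"
    proof
      assume "a \<in> e"
      moreover have "miss f a \<delta>'" using a[of \<delta>'] k ne by simp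
      ultimately have "f e = Some \<pi>" using fe unfolding miss_def by blast
      then show False using eac proper_map_inj[OF pr ac, of e a] \<open>a \<in> e\<close> by blast
    qed
    moreover have "(h({w, x} := None)) e = Some \<pi> \<or> (h({w, x} := None)) e = Some \<delta>'"
      using fe eac \<open>e \<noteq> {a, b}\<close> unfolding h_def by auto
    then have "e \<subseteq> kempe_comp (h({w, x} := None)) \<pi> \<delta>' w"
      by (rule kempe_closedD[OF kempe_closed_comp]) (use e(2) in blast)
    ultimately show "e \<subseteq> ?T" by blast
  qed
  then have "kempe_comp (f({w, x} := None)) \<pi> \<delta>' w \<subseteq> ?T"
    by (rule kempe_comp_least) (use kempe_comp_refl dist in auto)
  then show False using g by blast
qed

text \<open>Two flips reduce to the case in which \<open>wx\<close> has colour \<open>\<pi>\<close>,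
  the only colour present at \<open>a\<close>.\<close>

lemma kite:
  assumes col: "colors k (E - {{a, b}}) f" and ab: "{a, b} \<in> E" and V: "w \<in> V"
    and dist: "distinct [a, b, c, w, x, y]" and ac: "f {a, c} = Some \<pi>"
    and b: "miss f b \<pi>" and a: "\<And>\<theta>. \<theta> < k \<Longrightarrow> miss f a \<theta> \<longleftrightarrow> \<theta> \<noteq> \<pi>"
    and xy: "miss f x \<eta>" "miss f y \<eta>" "\<eta> < k"
    and full: "\<And>v \<theta>. v \<in> V \<Longrightarrow> \<theta> < k \<Longrightarrow> miss f v \<theta> \<Longrightarrow>
        v = a \<or> (v = b \<and> \<theta> = \<pi>) \<or> ((v = x \<or> v = y) \<and> \<theta> = \<eta>)"
    and inE: "{b, w} \<in> E" "{c, w} \<in> E" "{w, x} \<in> E" "{w, y} \<in> E"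
  shows False
proof -
  \<comment> \<open>The invariant of the flips: \<open>\<pi>\<close> and the colours at
    \<open>a\<close> and \<open>b\<close> stay, only the colour missing at \<open>x\<close> and
    \<open>y\<close> varies.\<close>
  define Q where "Q f \<eta> \<longleftrightarrow> colors k (E - {{a, b}}) f \<and> f {a, c} = Some \<pi> \<and> miss f b \<pi> \<and>
    (\<forall>\<theta><k. miss f a \<theta> \<longleftrightarrow> \<theta> \<noteq> \<pi>) \<and> miss f x \<eta> \<and> miss f y \<eta> \<and>
    (\<forall>v\<in>V. \<forall>\<theta><k. miss f v \<theta> \<longrightarrow> v = a \<or> (v = b \<and> \<theta> = \<pi>) \<or> ((v = x \<or> v = y) \<and> \<theta> = \<eta>))" for f \<eta>
  have \<pi>k: "\<pi> < k" using colors_lt[OF col ac] .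
  have edge: "\<exists>\<theta>. f e = Some \<theta>" if "Q f \<eta>" "e \<in> E" "e \<noteq> {a, b}" for f \<eta> e
    using that unfolding Q_def colors_def by blast
  have wne: "{b, w} \<noteq> {a, b}" "{c, w} \<noteq> {a, b}" "{w, x} \<noteq> {a, b}" "{w, y} \<noteq> {a, b}"
    using dist by (auto simp: doubleton_eq_iff)
  \<comment> \<open>Every colour other than \<open>\<pi>\<close> is missing at \<open>a\<close>, so
    it can be flipped with \<open>\<pi>\<close>. Both \<open>x\<close> and \<open>y\<close> miss one
    of the flipped colours and therefore change together.\<close>
  have flip: "\<exists>f'. Q f' (transpose \<theta> \<pi> \<eta>) \<and> (\<forall>e. x \<in> e \<longrightarrow> f' e = map_option (transpose \<theta> \<pi>) (f e))"
    if Q: "Q f \<eta>" and \<theta>: "\<theta> < k" "\<theta> \<noteq> \<pi>" and \<eta>: "\<eta> = \<theta> \<or> \<eta> = \<pi>" for f \<eta> \<theta>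
  proof -
    have colf: "colors k (E - {{a, b}}) f" and af: "miss f a \<theta>" and bf: "miss f b \<pi>"
      and xf: "miss f x \<eta>" "miss f y \<eta>" and acf: "f {a, c} = Some \<pi>"
      using Q \<theta> unfolding Q_def by auto
    obtain T where T: "kempe_closed f \<theta> \<pi> T" "a \<notin> T" "b \<notin> T"
      "\<And>x. x \<noteq> a \<Longrightarrow> x \<noteq> b \<Longrightarrow> miss f x \<theta> \<or> miss f x \<pi> \<Longrightarrow> x \<in> T"
      "colors k (E - {{a, b}}) (kempe_swap \<theta> \<pi> T f)"
      using uncolored_edge_flip[OF nc _ colf ab af bf \<theta>(1) \<pi>k] EV by blast
    let ?f = "kempe_swap \<theta> \<pi> T f"
    have xT: "x \<in> T" "y \<in> T" using T(4) xf \<eta> dist by auto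
    have m: "miss ?f p \<zeta> \<longleftrightarrow> miss f p (if p \<in> T then transpose \<theta> \<pi> \<zeta> else \<zeta>)" for p \<zeta>
      by (rule kempe_swap_miss[OF T(1)])
    have "?f {a, c} = Some \<pi>" using kempe_swap_outside[OF T(1), of a] T(2) acf by simp
    moreover have "\<forall>v\<in>V. \<forall>\<zeta><k. miss ?f v \<zeta> \<longrightarrow>
        v = a \<or> (v = b \<and> \<zeta> = \<pi>) \<or> ((v = x \<or> v = y) \<and> \<zeta> = transpose \<theta> \<pi> \<eta>)"
    proof (intro ballI allI impI)
      fix p \<zeta> assume p: "p \<in> V" "\<zeta> < k" "miss ?f p \<zeta>"
      let ?\<zeta> = "if p \<in> T then transpose \<theta> \<pi> \<zeta> else \<zeta>"
      have "miss f p ?\<zeta>" using p m by simp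
      moreover have "?\<zeta> < k" using p \<theta> \<pi>k by (auto simp: transpose_def)
      ultimately have "p = a \<or> (p = b \<and> ?\<zeta> = \<pi>) \<or> ((p = x \<or> p = y) \<and> ?\<zeta> = \<eta>)"
        using Q p(1) unfolding Q_def by blast
      then show "p = a \<or> (p = b \<and> \<zeta> = \<pi>) \<or> ((p = x \<or> p = y) \<and> \<zeta> = transpose \<theta> \<pi> \<eta>)"
        using T(3) xT by (metis transpose_involutory)
    qed
    ultimately have "Q ?f (transpose \<theta> \<pi> \<eta>)"
      using Q T m xT unfolding Q_def by simp
    moreover have "\<forall>e. x \<in> e \<longrightarrow> ?f e = map_option (transpose \<theta> \<pi>) (f e)"
      using xT(1) by (simp add: kempe_swap_inside)
    ultimately show ?thesis by blast
  qed
  have "Q f \<eta>" unfolding Q_def using col ac b a xy full by simp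
  \<comment> \<open>The first flip makes \<open>x\<close> and \<open>y\<close> miss
    \<open>\<pi>\<close>. The second, with the colour \<open>\<delta>\<close> of \<open>wx\<close>,
    gives \<open>wx\<close> the colour \<open>\<pi>\<close> and makes \<open>x\<close> and
    \<open>y\<close> miss \<open>\<delta>\<close>.\<close>
  then have "\<exists>f. Q f \<pi>"
    using flip[of f \<eta> \<eta>] xy(3) by (cases "\<eta> = \<pi>") auto
  then obtain f1 where f1: "Q f1 \<pi>" by blast
  obtain \<delta> where \<delta>: "f1 {w, x} = Some \<delta>" using edge[OF f1] inE wne by blast
  have "miss f1 x \<pi>" using f1 unfolding Q_def by blast
  then have \<delta>\<pi>: "\<delta> \<noteq> \<pi>" using not_missI[of f1, OF \<delta>, of x] by auto
  have "colors k (E - {{a, b}}) f1" using f1 unfolding Q_def by blast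
  then have \<delta>k: "\<delta> < k" using colors_lt \<delta> by metis
  obtain f2 where f2: "Q f2 \<delta>" "\<forall>e. x \<in> e \<longrightarrow> f2 e = map_option (transpose \<delta> \<pi>) (f1 e)"
    using flip[OF f1 \<delta>k \<delta>\<pi>] by auto
  have wx: "f2 {w, x} = Some \<pi>" using f2(2) \<delta> by simp
  obtain \<gamma> \<kappa> \<delta>' where c: "f2 {b, w} = Some \<gamma>" "f2 {c, w} = Some \<kappa>" "f2 {w, y} = Some \<delta>'"
    using edge[OF f2(1)] inE wne by meson
  have Qs: "colors k (E - {{a, b}}) f2" "f2 {a, c} = Some \<pi>" "miss f2 b \<pi>" "miss f2 x \<delta>" "miss f2 y \<delta>"
    "\<And>\<theta>. \<theta> < k \<Longrightarrow> miss f2 a \<theta> \<longleftrightarrow> \<theta> \<noteq> \<pi>"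
    "\<And>v \<theta>. v \<in> V \<Longrightarrow> \<theta> < k \<Longrightarrow> miss f2 v \<theta> \<Longrightarrow>
        v = a \<or> (v = b \<and> \<theta> = \<pi>) \<or> ((v = x \<or> v = y) \<and> \<theta> = \<delta>)"
    using f2(1) unfolding Q_def by blast+
  show False
    by (rule kite_reduced[OF Qs(1) ab V dist Qs(2,3,6,4,5) \<delta>k Qs(7) c(1,2) wx c(3)])
qed

end

subsection \<open>Splitting a vertex of a 1-factorized graph\<close>

text \<open>Pigeonhole: the edges of \<open>K\<close> have distinct colours, and without
  \<open>\<theta>\<close> only \<open>k - 1\<close> would be available.\<close>

lemma saturated_no_miss:
  assumes col: "colors k E c" and K: "finite K" "card K \<ge> k" "\<And>e. e \<in> K \<Longrightarrow> e \<in> E \<and> p \<in> e" and "\<theta> < k"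
  shows "\<not> miss c p \<theta>"
proof
  assume m: "miss c p \<theta>"
  let ?h = "\<lambda>e. the (c e)"
  have some: "c e = Some (?h e)" if "e \<in> K" for e
    using K(3)[OF that] col unfolding colors_def by (simp add: dom_def) auto
  have "inj_on ?h K"
  proof (rule inj_onI)
    fix e e' assume e: "e \<in> K" "e' \<in> K" "?h e = ?h e'"
    show "e = e'"
      by (rule proper_map_inj[OF colors_proper[OF col], of e "?h e" e' p])
        (use e some[of e] some[of e'] K(3) in simp_all)
  qed
  moreover have "?h ` K \<subseteq> {..<k} - {\<theta>}"
  proof
    fix t assume "t \<in> ?h ` K"
    then obtain e where e: "e \<in> K" "t = ?h e" by blast
    have "c e = Some t" using some[OF e(1)] e(2) by simp
    then show "t \<in> {..<k} - {\<theta>}"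
      using m K(3)[OF e(1)] colors_lt[OF col, of e t] unfolding miss_def by auto
  qed
  ultimately have "card K \<le> card ({..<k} - {\<theta>})" by (intro card_inj_on_le) auto
  then show False using K(2) \<open>\<theta> < k\<close> by simp
qed

text \<open>The regular graph is given by \<open>V0\<close> and \<open>E0\<close>; \<open>A\<close>
  and \<open>B\<close> are the neighbours of \<open>v\<close> handed to the halves \<open>a\<close>
  and \<open>b\<close>. As \<open>k\<close> is both the degree and the number of colours,
  \<open>\<phi>\<close> is a 1-factorization.\<close>

locale split_graph =
  fixes V0 :: "'a set" and E0 :: "'a set set" and v a b :: 'a and A B :: "'a set"
    and \<phi> :: "'a set \<rightharpoonup> nat" and k :: nat
  assumes finV0: "finite V0" and E0: "\<And>e. e \<in> E0 \<Longrightarrow> card e = 2 \<and> e \<subseteq> V0"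
    and vV0: "v \<in> V0" and aV0: "a \<notin> V0" and bV0: "b \<notin> V0" and ab: "a \<noteq> b"
    and AB: "A \<union> B = {u. {v, u} \<in> E0}" "A \<inter> B = {}" "A \<noteq> {}" "B \<noteq> {}"
    and col0: "colors k E0 \<phi>" and reg: "\<And>p. p \<in> V0 \<Longrightarrow> card {u. {p, u} \<in> E0} = k"
begin

definition nb :: "'a \<Rightarrow> 'a set" where "nb p = {u. {p, u} \<in> E0}"

definition E :: "'a set set" where
  "E = {e \<in> E0. v \<notin> e} \<union> {{a, b}} \<union> {{a, p} | p. p \<in> A} \<union> {{b, p} | p. p \<in> B}"

definition V :: "'a set" where "V = (V0 - {v}) \<union> {a, b}"

text \<open>The colour is read off after contracting \<open>a\<close> and \<open>b\<close> back to
  \<open>v\<close>; only \<open>ab\<close> has no counterpart.\<close>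

definition f :: "'a set \<rightharpoonup> nat" where
  "f e = (if e \<in> E \<and> e \<noteq> {a, b} then \<phi> ((\<lambda>z. if z = a \<or> z = b then v else z) ` e) else None)"

section \<open>The split graph and its inherited colouring\<close>

lemma E0_pair: "{p, q} \<in> E0 \<Longrightarrow> p \<noteq> q \<and> p \<in> V0 \<and> q \<in> V0"
  using E0[of "{p, q}"] by (cases "p = q") auto

lemma nb_subset: "nb p \<subseteq> V0 - {p}"
  unfolding nb_def using E0_pair by blast

lemma card_nb: "p \<in> V0 \<Longrightarrow> card (nb p) = k"
  using reg unfolding nb_def .

lemma finite_nb: "finite (nb p)"
  using nb_subset finV0 by (meson finite_Diff finite_subset)

lemma nb_v: "nb v = A \<union> B" using AB unfolding nb_def by simp

lemma AB_V0: "p \<in> A \<union> B \<Longrightarrow> p \<in> V0 \<and> p \<noteq> v \<and> p \<noteq> a \<and> p \<noteq> b \<and> {v, p} \<in> E0"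
  using AB(1) E0_pair[of v p] aV0 bV0 by blast

lemma k_pos: "k > 0"
  using card_nb[OF vV0] finite_nb[of v] AB nb_v by (metis Un_empty card_gt_0_iff)

lemma E_cases:
  assumes "e \<in> E"
  obtains "e \<in> E0" "v \<notin> e" "a \<notin> e" "b \<notin> e" | "e = {a, b}" | p where "p \<in> A" "e = {a, p}"
    | p where "p \<in> B" "e = {b, p}"
  using assms E0 aV0 bV0 unfolding E_def by blast

lemma E_V: "e \<in> E \<Longrightarrow> card e = 2 \<and> e \<subseteq> V"
proof (erule E_cases)
  show "card e = 2 \<and> e \<subseteq> V" if "e \<in> E0" "v \<notin> e"
    using that E0[of e] unfolding V_def by blast
  show "card e = 2 \<and> e \<subseteq> V" if "e = {a, b}"
    using that ab unfolding V_def by simp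
  show "card e = 2 \<and> e \<subseteq> V" if "p \<in> A" "e = {a, p}" for p
    using that AB_V0[of p] unfolding V_def by auto
  show "card e = 2 \<and> e \<subseteq> V" if "p \<in> B" "e = {b, p}" for p
    using that AB_V0[of p] unfolding V_def by auto
qed

lemma finV: "finite V" unfolding V_def using finV0 by simp

lemma ab_E: "{a, b} \<in> E" unfolding E_def by simp

lemma f_base: "e \<in> E0 \<Longrightarrow> v \<notin> e \<Longrightarrow> f e = \<phi> e"
proof -
  assume e: "e \<in> E0" "v \<notin> e"
  then have n: "a \<notin> e" "b \<notin> e" using E0 aV0 bV0 by blast+
  then have "(\<lambda>z. if z = a \<or> z = b then v else z) ` e = id ` e" by (intro image_cong) auto
  then show ?thesis using e n unfolding f_def E_def by auto
qed

lemma f_a: "p \<in> A \<Longrightarrow> f {a, p} = \<phi> {v, p}"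
  and f_b: "p \<in> B \<Longrightarrow> f {b, p} = \<phi> {v, p}"
  using AB_V0[of p] unfolding f_def E_def by (auto simp: doubleton_eq_iff insert_commute)

lemma f_cases:
  assumes "f e = Some \<theta>"
  obtains "e \<in> E0" "v \<notin> e" "a \<notin> e" "b \<notin> e" "\<phi> e = Some \<theta>"
    | p where "p \<in> A" "e = {a, p}" "\<phi> {v, p} = Some \<theta>"
    | p where "p \<in> B" "e = {b, p}" "\<phi> {v, p} = Some \<theta>"
proof -
  have "e \<in> E" "e \<noteq> {a, b}" using assms unfolding f_def by (auto split: if_splits)
  then show ?thesis
    by (elim E_cases) (use assms f_a f_b f_base that in auto)
qed

lemma E0_colored: "e \<in> E0 \<Longrightarrow> \<exists>\<theta><k. \<phi> e = Some \<theta>"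
  using col0 colors_lt[OF col0] unfolding colors_def by blast

lemma phi_inj: "\<phi> {p, q} = Some \<theta> \<Longrightarrow> \<phi> {p, q'} = Some \<theta> \<Longrightarrow> q = q'"
  using proper_map_inj[OF colors_proper[OF col0], of "{p, q}" \<theta> "{p, q'}" p]
  by (auto simp: doubleton_eq_iff)

text \<open>By this symmetry every result about one half can also be used for the other.\<close>

lemma swapped: "split_graph V0 E0 v b a B A \<phi> k"
  by unfold_locales (use finV0 E0 vV0 aV0 bV0 ab AB col0 reg in auto)

text \<open>Edges sharing a vertex still share one after contraction, and distinct coloured edges
  stay distinct because \<open>A\<close> and \<open>B\<close> are disjoint.\<close>

lemma f_colors: "colors k (E - {{a, b}}) f"
  unfolding colors_def
proof (intro conjI)
  have "e \<in> dom f" if "e \<in> E" "e \<noteq> {a, b}" for e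
    using that(1)
  proof (cases rule: E_cases)
    case 1
    then show ?thesis using f_base[of e] E0_colored[of e] by auto
  next
    case (3 p)
    then show ?thesis using f_a[of p] AB_V0[of p] E0_colored[of "{v, p}"] by auto
  next
    case (4 p)
    then show ?thesis using f_b[of p] AB_V0[of p] E0_colored[of "{v, p}"] by auto
  qed (use that in auto)
  then show "dom f = E - {{a, b}}" by (auto simp: f_def split: if_splits)
  show "ran f \<subseteq> {..<k}"
    by (auto simp: ran_def elim!: f_cases dest: colors_lt[OF col0])
  show "proper_map f"
    unfolding proper_map_def
  proof (intro allI impI, elim conjE)
    fix e e' \<theta> assume e: "f e = Some \<theta>" "f e' = Some \<theta>" "e \<inter> e' \<noteq> {}"
    obtain z where z: "z \<in> e" "z \<in> e'" using e(3) by blast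
    have inj: "d = d'" if "\<phi> d = Some \<theta>" "\<phi> d' = Some \<theta>" "z' \<in> d" "z' \<in> d'" for d d' z'
      using proper_map_inj[OF colors_proper[OF col0]] that by blast
    from e(1) show "e = e'"
    proof (cases rule: f_cases)
      case 1
      from e(2) show ?thesis
      proof (cases rule: f_cases)
        case one: 1
        then show ?thesis using 1 inj z by blast
      next
        case (2 p)
        then show ?thesis using 1 inj[of e "{v, p}" p] z by auto
      next
        case (3 p)
        then show ?thesis using 1 inj[of e "{v, p}" p] z by auto
      qed
    next
      case (2 p)
      from e(2) show ?thesis
      proof (cases rule: f_cases)
        case 1
        then show ?thesis using 2 inj[of e' "{v, p}" p] z by auto
      next
        case two: (2 q)
        then show ?thesis using 2 phi_inj by blast
      next
        case (3 q)
        then have "p = q" using 2 phi_inj by blast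
        then show ?thesis using 2 3 AB by blast
      qed
    next
      case (3 p)
      from e(2) show ?thesis
      proof (cases rule: f_cases)
        case 1
        then show ?thesis using 3 inj[of e' "{v, p}" p] z by auto
      next
        case (2 q)
        then have "p = q" using 3 phi_inj by blast
        then show ?thesis using 2 3 AB by blast
      next
        case three: (3 q)
        then show ?thesis using 3 phi_inj by blast
      qed
    qed
  qed
qed

section \<open>Degrees, saturated vertices and parity\<close>

lemma nb_E: "p \<in> V0 - {v} \<Longrightarrow>
   {u. {p, u} \<in> E} = (\<lambda>u. if u = v then if p \<in> A then a else b else u) ` nb p"
  (is "_ \<Longrightarrow> ?L = ?h ` _")
proof
  assume p: "p \<in> V0 - {v}"
  show "?L \<subseteq> ?h ` nb p"
  proof
    fix u assume "u \<in> ?L"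
    then have "{p, u} \<in> E" by simp
    then show "u \<in> ?h ` nb p"
    proof (cases rule: E_cases)
      case 1
      then show ?thesis unfolding nb_def by (intro image_eqI[of _ _ u]) auto
    next
      case 2
      then show ?thesis using p aV0 bV0 by (auto simp: doubleton_eq_iff)
    next
      case (3 q)
      then have "q = p" "u = a" using p aV0 by (auto simp: doubleton_eq_iff)
      then show ?thesis using 3 AB_V0[of p] unfolding nb_def
        by (intro image_eqI[of _ _ v]) (auto simp: insert_commute)
    next
      case (4 q)
      then have "q = p" "u = b" using p bV0 by (auto simp: doubleton_eq_iff)
      moreover have "q \<notin> A" using 4 AB by blast
      ultimately show ?thesis using 4 AB_V0[of p] unfolding nb_def
        by (intro image_eqI[of _ _ v]) (auto simp: insert_commute)
    qed
  qed
  show "?h ` nb p \<subseteq> ?L"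
  proof (rule image_subsetI)
    fix u assume u: "u \<in> nb p"
    show "?h u \<in> ?L"
    proof (cases "u = v")
      case True
      then have "p \<in> A \<union> B" using u AB(1) unfolding nb_def by (auto simp: insert_commute)
      then show ?thesis using True unfolding E_def by (auto simp: insert_commute)
    next
      case False
      then show ?thesis using u p unfolding E_def nb_def by auto
    qed
  qed
qed

lemma card_nb_E: "p \<in> V0 - {v} \<Longrightarrow> card {u. {p, u} \<in> E} = k"
proof -
  assume p: "p \<in> V0 - {v}"
  have "inj_on (\<lambda>u. if u = v then if p \<in> A then a else b else u) (nb p)"
    using nb_subset[of p] aV0 bV0 by (auto simp: inj_on_def)
  then show ?thesis unfolding nb_E[OF p] using card_nb[of p] p card_image by fastforce
qed

lemma nb_E_a: "{u. {a, u} \<in> E} = insert b A"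
proof (intro subset_antisym subsetI)
  fix u assume "u \<in> {u. {a, u} \<in> E}"
  then have "{a, u} \<in> E" by simp
  then show "u \<in> insert b A"
    by (cases rule: E_cases) (use ab AB_V0 in \<open>auto simp: doubleton_eq_iff\<close>)
qed (auto simp: E_def)

text \<open>Away from the two halves the degree is still \<open>k\<close>, so all \<open>k\<close>
  colours occur.\<close>

lemma full_vertex:
  assumes col: "colors k F c" and F: "{e \<in> E. p \<in> e} \<subseteq> F" and p: "p \<in> V0 - {v}" and "\<theta> < k"
  shows "\<not> miss c p \<theta>"
proof (rule saturated_no_miss[OF col])
  let ?K = "(\<lambda>u. {p, u}) ` {u. {p, u} \<in> E}"
  have inj: "inj_on (\<lambda>u. {p, u}) {u. {p, u} \<in> E}" by (auto simp: inj_on_def doubleton_eq_iff)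
  then have "card ?K = k" using card_nb_E[OF p] by (simp add: card_image)
  then show "k \<le> card ?K" "finite ?K" using k_pos by (auto intro: card_ge_0_finite)
  show "e \<in> F \<and> p \<in> e" if "e \<in> ?K" for e using that F by auto
qed fact

lemma phi_full: "p \<in> V0 \<Longrightarrow> \<theta> < k \<Longrightarrow> \<exists>u\<in>nb p. \<phi> {p, u} = Some \<theta>"
proof -
  assume p: "p \<in> V0" "\<theta> < k"
  have "\<not> miss \<phi> p \<theta>"
  proof (rule saturated_no_miss[OF col0])
    let ?K = "(\<lambda>u. {p, u}) ` nb p"
    have inj: "inj_on (\<lambda>u. {p, u}) (nb p)" by (auto simp: inj_on_def doubleton_eq_iff)
    then show "k \<le> card ?K" "finite ?K" using card_nb[OF p(1)] finite_nb by (simp_all add: card_image)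
    show "e \<in> E0 \<and> p \<in> e" if "e \<in> ?K" for e using that by (auto simp: nb_def)
  qed fact
  then obtain e where e: "p \<in> e" "\<phi> e = Some \<theta>" unfolding miss_def by blast
  then have "e \<in> E0" using col0 unfolding colors_def by blast
  then have "card e = 2" using E0 by blast
  then obtain u where "e = {p, u}" using e(1) by (auto simp: card_2_iff)
  then show ?thesis using e \<open>e \<in> E0\<close> unfolding nb_def by blast
qed

lemma miss_a_iff: "\<theta> < k \<Longrightarrow> miss f a \<theta> \<longleftrightarrow> \<not> (\<exists>p\<in>A. \<phi> {v, p} = Some \<theta>)"
proof -
  assume "\<theta> < k"
  have "\<not> miss f a \<theta> \<longleftrightarrow> (\<exists>p\<in>A. \<phi> {v, p} = Some \<theta>)"
  proof
    assume "\<not> miss f a \<theta>"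
    then obtain e where e: "a \<in> e" "f e = Some \<theta>" unfolding miss_def by blast
    from e(2) show "\<exists>p\<in>A. \<phi> {v, p} = Some \<theta>"
    proof (cases rule: f_cases)
      case (3 p)
      then show ?thesis using e(1) ab AB_V0[of p] by auto
    qed (use e in auto)
  next
    assume "\<exists>p\<in>A. \<phi> {v, p} = Some \<theta>"
    then obtain p where "p \<in> A" "f {a, p} = Some \<theta>" using f_a by auto
    then show "\<not> miss f a \<theta>" by (intro not_missI) auto
  qed
  then show ?thesis by blast
qed

lemma miss_b_iff: "\<theta> < k \<Longrightarrow> miss f b \<theta> \<longleftrightarrow> \<not> (\<exists>p\<in>B. \<phi> {v, p} = Some \<theta>)"
proof -
  interpret sw: split_graph V0 E0 v b a B A \<phi> k by (rule swapped)
  have "sw.E = E" unfolding E_def sw.E_def by (auto simp: insert_commute)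
  then have "sw.f = f" unfolding f_def sw.f_def by (auto simp: insert_commute disj_commute fun_eq_iff)
  then show "\<theta> < k \<Longrightarrow> ?thesis" using sw.miss_a_iff by simp
qed

text \<open>Each colour occurs on exactly one edge at \<open>v\<close>, and that edge goes to
  exactly one half.\<close>

lemma miss_complementary:
  assumes "\<theta> < k"
  shows "miss f a \<theta> \<longleftrightarrow> \<not> miss f b \<theta>"
proof -
  obtain u where u: "u \<in> A \<union> B" "\<phi> {v, u} = Some \<theta>" using phi_full[OF vV0 assms] nb_v by blast
  have "u = p" if "\<phi> {v, p} = Some \<theta>" for p using phi_inj[OF u(2) that] .
  then show ?thesis using u AB(2) unfolding miss_a_iff[OF assms] miss_b_iff[OF assms] by blast
qed

text \<open>The class of colour 0, available since \<open>k\<close> is positive, is a perfect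
  matching.\<close>

lemma even_card_V0: "even (card V0)"
proof -
  have "even (card {p \<in> V0. \<not> miss \<phi> p 0})"
    by (rule even_card_saturated[OF colors_proper[OF col0]])
      (use finV0 E0 col0 in \<open>auto simp: colors_def\<close>)
  moreover have "{p \<in> V0. \<not> miss \<phi> p 0} = V0"
    using phi_full[OF _ k_pos] unfolding miss_def by fastforce
  ultimately show ?thesis by simp
qed

text \<open>The colour of \<open>ab\<close> would occur at \<open>a\<close> and \<open>b\<close> on
  that edge and elsewhere by saturation, giving a perfect matching on an odd number of
  vertices.\<close>

lemma not_colorable: "\<nexists>c. colors k E c"
proof
  assume "\<exists>c. colors k E c"
  then obtain c where c: "colors k E c" by blast
  obtain \<theta> where \<theta>: "c {a, b} = Some \<theta>" using c ab_E unfolding colors_def by blast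
  have "\<theta> < k" using colors_lt[OF c \<theta>] .
  have "even (card {p \<in> V. \<not> miss c p \<theta>})"
    by (rule even_card_saturated[OF colors_proper[OF c]])
      (use finV E_V c in \<open>auto simp: colors_def\<close>)
  moreover have "{p \<in> V. \<not> miss c p \<theta>} = V"
    using full_vertex[OF c _ _ \<open>\<theta> < k\<close>] not_missI[of c, OF \<theta>] unfolding V_def by auto
  moreover have "card V = Suc (card V0)"
  proof -
    have "card (V0 - {v}) = card V0 - 1" "card V0 > 0"
      using finV0 vV0 by (auto simp: card_gt_0_iff)
    then show ?thesis unfolding V_def using finV0 aV0 bV0 ab by (simp add: card_insert_if)
  qed
  ultimately show False using even_card_V0 by simp
qed

lemma swapped_E: "split_graph.E E0 v b a B A = E"
proof -
  interpret sw: split_graph V0 E0 v b a B A \<phi> k by (rule swapped)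
  show ?thesis unfolding E_def sw.E_def by (auto simp: insert_commute)
qed

text \<open>The colour of \<open>ap\<close> is present at \<open>a\<close>, hence missing at
  \<open>b\<close>, and can be moved to \<open>ab\<close>.\<close>

lemma colorable_delete_at_a:
  assumes p: "p \<in> A"
  shows "\<exists>c. colors k (E - {{a, p}}) c"
proof -
  obtain \<theta> where \<theta>: "\<theta> < k" "\<phi> {v, p} = Some \<theta>" using E0_colored AB_V0 p by blast
  have f: "f {a, p} = Some \<theta>" using f_a[OF p] \<theta> by simp
  have "\<not> miss f a \<theta>" using miss_a_iff \<theta> p by blast
  then have m: "miss f b \<theta>" using miss_complementary \<theta> by blast
  have "b \<noteq> p" using AB_V0 p by blast
  then show ?thesis using colors_shift[OF f_colors ab_E _ f m] by blast
qed

section \<open>Deleting an edge away from the split vertex, by contradiction\<close>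

context
  fixes x y :: 'a
  assumes nc: "\<nexists>c. colors k (E - {{x, y}}) c" and xyE0: "{x, y} \<in> E0" and xyv: "x \<noteq> v" "y \<noteq> v"
begin

abbreviation (input) "E' \<equiv> E - {{x, y}}"
abbreviation (input) "f' \<equiv> f({x, y} := None)"

lemma xy_facts: "x \<noteq> y" "x \<in> V0 - {v}" "y \<in> V0 - {v}" "x \<noteq> a" "x \<noteq> b" "y \<noteq> a" "y \<noteq> b"
  using E0_pair[OF xyE0] xyv aV0 bV0 by blast+

lemma xy_missing: "\<exists>\<eta><k. f {x, y} = Some \<eta> \<and> miss f' x \<eta> \<and> miss f' y \<eta>"
proof -
  obtain \<eta> where \<eta>: "\<eta> < k" "\<phi> {x, y} = Some \<eta>" using E0_colored[OF xyE0] by blast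
  then have "f {x, y} = Some \<eta>" using f_base[OF xyE0] xyv by auto
  then show ?thesis
    using \<eta> miss_uncolor_same[OF colors_proper[OF f_colors], of "{x, y}" \<eta>] by blast
qed

lemma f'_at: "a \<in> e \<or> b \<in> e \<Longrightarrow> f' e = f e"
  using xy_facts by auto

lemma miss_f'_ab: "p = a \<or> p = b \<Longrightarrow> miss f' p \<theta> \<longleftrightarrow> miss f p \<theta>"
  using xy_facts unfolding miss_def by auto

lemma f'_colors: "colors k (E' - {{a, b}}) f'"
proof -
  have "E' - {{a, b}} = E - {{a, b}} - {{x, y}}" by blast
  then show ?thesis using colors_uncolor[OF f_colors] by simp
qed

lemma f'_split: "split_state k E' a b"
  by unfold_locales (use nc E_V ab_E xy_facts in \<open>auto simp: doubleton_eq_iff\<close>)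

lemma f'_state: "split_state.state k E' a b f'"
proof -
  interpret split_state k E' a b by (rule f'_split)
  show ?thesis unfolding state_def
    using f'_colors miss_f'_ab miss_complementary by blast
qed

text \<open>This is the supply of colours missing at \<open>b\<close>: one for each vertex of
  \<open>A\<close>.\<close>

lemma color_at_A: "p \<in> A \<Longrightarrow> \<exists>\<epsilon><k. \<phi> {v, p} = Some \<epsilon> \<and> miss f' b \<epsilon>"
proof -
  assume p: "p \<in> A"
  obtain \<epsilon> where \<epsilon>: "\<epsilon> < k" "\<phi> {v, p} = Some \<epsilon>" using E0_colored AB_V0 p by blast
  then have "\<not> miss f a \<epsilon>" using miss_a_iff p by blast
  then have "miss f' b \<epsilon>" using miss_complementary[OF \<epsilon>(1)] miss_f'_ab[of b] by blast
  then show ?thesis using \<epsilon> by blast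
qed

text \<open>\<open>x\<close> misses the colour of the deleted edge, and \<open>b\<close> misses a
  colour because \<open>A\<close> is nonempty, so \<open>state_deficient_neighbor\<close>
  applies.\<close>

lemma x_notin_B: "x \<notin> B"
proof
  assume x: "x \<in> B"
  interpret split_state k E' a b by (rule f'_split)
  obtain \<eta> where \<eta>: "\<eta> < k" "miss f' x \<eta>" using xy_missing by blast
  obtain p where "p \<in> A" using AB by blast
  then obtain \<epsilon> where \<epsilon>: "\<epsilon> < k" "miss f' b \<epsilon>" using color_at_A by blast
  obtain \<gamma> where "\<phi> {v, x} = Some \<gamma>" using E0_colored AB_V0 x by blast
  then have "f' {b, x} = Some \<gamma>" using f_b[OF x] f'_at[of "{b, x}"] by simp
  then show False
    using state_deficient_neighbor[OF f'_state _ _ \<eta>(2,1) _ \<epsilon>(2,1)] xy_facts by blast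
qed

text \<open>Two vertices of \<open>A\<close> give two colours missing at \<open>b\<close>. A common
  neighbour \<open>u\<close> in \<open>B\<close> differs from \<open>y\<close>, so \<open>ux\<close>
  is not the deleted edge.\<close>

lemma no_common_neighbor_in_B:
  assumes A: "p \<in> A" "q \<in> A" "p \<noteq> q" and y: "y \<notin> B"
  shows "B \<inter> nb x = {}"
proof (rule ccontr)
  assume "B \<inter> nb x \<noteq> {}"
  then obtain u where u: "u \<in> B" "u \<in> nb x" by blast
  interpret split_state k E' a b by (rule f'_split)
  obtain \<eta> where \<eta>: "\<eta> < k" "miss f' x \<eta>" using xy_missing by blast
  obtain \<epsilon>1 where \<epsilon>1: "\<epsilon>1 < k" "\<phi> {v, p} = Some \<epsilon>1" "miss f' b \<epsilon>1" using color_at_A A by blast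
  obtain \<epsilon>2 where \<epsilon>2: "\<epsilon>2 < k" "\<phi> {v, q} = Some \<epsilon>2" "miss f' b \<epsilon>2" using color_at_A A by blast
  have ne: "\<epsilon>1 \<noteq> \<epsilon>2" using phi_inj \<epsilon>1 \<epsilon>2 A by blast
  have uV: "u \<noteq> a" "u \<noteq> b" "u \<noteq> v" "{v, u} \<in> E0" using AB_V0 u by blast+
  have "u \<noteq> y" using u y by blast
  have uxE: "{u, x} \<in> E0" "u \<noteq> x" using u(2) nb_subset[of x] unfolding nb_def by (auto simp: insert_commute)
  obtain \<gamma> where "\<phi> {v, u} = Some \<gamma>" using E0_colored uV by blast
  then have bu: "f' {b, u} = Some \<gamma>" using f_b[OF u(1)] f'_at[of "{b, u}"] by simp
  obtain \<delta> where "\<phi> {u, x} = Some \<delta>" using E0_colored uxE by blast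
  then have "f {u, x} = Some \<delta>" using f_base[OF uxE(1)] uV xyv by auto
  then have ux: "f' {u, x} = Some \<delta>" using \<open>u \<noteq> y\<close> uxE by (auto simp: doubleton_eq_iff)
  show False
    by (rule state_deficient_distance_two[OF f'_state _ _ uV(1,2) uxE(2) \<eta>(2,1) bu ux \<epsilon>1(3) \<epsilon>2(3) ne \<epsilon>1(1) \<epsilon>2(1)])
      (use xy_facts in auto)
qed

text \<open>With a single vertex \<open>c\<close> in \<open>A\<close>, only the colour of
  \<open>vc\<close> is present at \<open>a\<close>; a common neighbour differs from
  \<open>c\<close>, so it lies in \<open>B\<close> and completes a kite.\<close>

lemma no_kite:
  assumes A: "A = {c}" and xy: "x \<notin> A \<union> B" "y \<notin> A \<union> B"
  shows "nb v \<inter> nb c \<inter> nb x \<inter> nb y = {}"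
proof (rule ccontr)
  assume "nb v \<inter> nb c \<inter> nb x \<inter> nb y \<noteq> {}"
  then obtain w where w: "w \<in> nb v" "w \<in> nb c" "w \<in> nb x" "w \<in> nb y" by blast
  have c: "c \<in> A" using A by simp
  have cV: "c \<in> V0" "c \<noteq> v" "c \<noteq> a" "c \<noteq> b" using AB_V0 c by blast+
  have "w \<noteq> c" using w nb_subset[of c] by blast
  then have wB: "w \<in> B" using w(1) nb_v A by blast
  have wV: "w \<in> V0" "w \<noteq> v" "w \<noteq> a" "w \<noteq> b" using AB_V0 wB by blast+
  have "w \<noteq> x" "w \<noteq> y" using w nb_subset[of x] nb_subset[of y] by blast+
  have "c \<noteq> x" "c \<noteq> y" using xy c by blast+
  obtain \<pi> where \<pi>: "\<pi> < k" "\<phi> {v, c} = Some \<pi>" "miss f' b \<pi>" using color_at_A c by blast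
  obtain \<eta> where \<eta>: "\<eta> < k" "f {x, y} = Some \<eta>" "miss f' x \<eta>" "miss f' y \<eta>" using xy_missing by blast
  have inE0: "{c, w} \<in> E0" "{w, x} \<in> E0" "{w, y} \<in> E0" using w unfolding nb_def by (auto simp: insert_commute)
  show False
  proof (rule kite[OF nc, of V a b f' w c x y \<pi> \<eta>])
    show "\<And>e. e \<in> E' \<Longrightarrow> card e = 2 \<and> e \<subseteq> V" using E_V by blast
    show "finite V" by (rule finV)
    show "colors k (E' - {{a, b}}) f'" by (rule f'_colors)
    show "{a, b} \<in> E'" using ab_E xy_facts by (auto simp: doubleton_eq_iff)
    show "w \<in> V" using wV unfolding V_def by blast
    show "distinct [a, b, c, w, x, y]"
      using ab cV wV xy_facts \<open>w \<noteq> c\<close> \<open>w \<noteq> x\<close> \<open>w \<noteq> y\<close> \<open>c \<noteq> x\<close> \<open>c \<noteq> y\<close> by auto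
    show "f' {a, c} = Some \<pi>" using f_a[OF c] \<pi> f'_at[of "{a, c}"] by simp
    show "miss f' b \<pi>" "miss f' x \<eta>" "miss f' y \<eta>" "\<eta> < k" using \<pi> \<eta> by blast+
    show "miss f' a \<theta> \<longleftrightarrow> \<theta> \<noteq> \<pi>" if "\<theta> < k" for \<theta>
      using miss_a_iff[OF that] miss_f'_ab[of a] A \<pi>(2) by auto
    show "{b, w} \<in> E'" "{c, w} \<in> E'" "{w, x} \<in> E'" "{w, y} \<in> E'"
      using inE0 wB cV wV xyv xy_facts \<open>w \<noteq> x\<close> \<open>w \<noteq> y\<close> \<open>c \<noteq> x\<close> \<open>c \<noteq> y\<close>
      unfolding E_def by (auto simp: doubleton_eq_iff)
    show "p = a \<or> (p = b \<and> \<theta> = \<pi>) \<or> ((p = x \<or> p = y) \<and> \<theta> = \<eta>)"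
      if p: "p \<in> V" "\<theta> < k" "miss f' p \<theta>" for p \<theta>
    proof (rule ccontr)
      assume *: "\<not> ?thesis"
      show False
      proof (cases "p = b")
        case True
        then have "miss f b \<theta>" using p(3) miss_f'_ab by blast
        then have "\<not> miss f a \<theta>" using miss_complementary[OF p(2)] by blast
        then have "\<phi> {v, c} = Some \<theta>" using miss_a_iff[OF p(2)] A by auto
        then show False using * True \<pi> by simp
      next
        case False
        then have pV: "p \<in> V0 - {v}" using p(1) * unfolding V_def by blast
        have "{e \<in> E. p \<in> e} \<subseteq> E - {{a, b}}" using pV aV0 bV0 by auto
        then have "\<not> miss f p \<theta>" using full_vertex[OF f_colors _ pV p(2)] by blast
        then obtain e where e: "p \<in> e" "f e = Some \<theta>" unfolding miss_def by blast
        \<comment> \<open>\<open>f\<close> saturates \<open>p\<close>, so a colour can be missing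
          there only through the deletion of \<open>xy\<close>.\<close>
        have "e = {x, y}"
        proof (rule ccontr)
          assume "e \<noteq> {x, y}"
          then have "f' e = Some \<theta>" using e by simp
          then show False using p(3) e(1) unfolding miss_def by blast
        qed
        then show False using e \<eta>(2) * by auto
      qed
    qed
  qed
qed

end

text \<open>For an edge \<open>xy\<close> avoiding the split vertex, neither end is adjacent to
  \<open>v\<close>. If both sides have two vertices, a common neighbour of \<open>v\<close> and
  \<open>x\<close> is excluded on each side, though density provides one. If one side is a single
  vertex, density provides a kite.\<close>

lemma colorable_delete:
  assumes dense: "3 * card V0 \<le> 4 * k" and e: "e \<in> E"
  shows "\<exists>c. colors k (E - {e}) c"
  using e
proof (cases rule: E_cases)
  case 2
  then show ?thesis using f_colors by blast
next
  case (3 p)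
  then show ?thesis using colorable_delete_at_a by blast
next
  case (4 p)
  interpret sw: split_graph V0 E0 v b a B A \<phi> k by (rule swapped)
  show ?thesis using 4 sw.colorable_delete_at_a swapped_E by simp
next
  case 1
  interpret sw: split_graph V0 E0 v b a B A \<phi> k by (rule swapped)
  have swE: "sw.E = E" by (rule swapped_E)
  have "card e = 2" using E0 1 by blast
  then obtain x y where exy: "e = {x, y}" "x \<noteq> y" by (auto simp: card_2_iff)
  have xy: "{x, y} \<in> E0" "x \<noteq> v" "y \<noteq> v" using 1 exy by auto
  then have yx: "{y, x} \<in> E0" by (simp add: insert_commute)
  have xyV: "x \<in> V0" "y \<in> V0" using E0_pair[OF xy(1)] by blast+
  show ?thesis
  proof (rule ccontr)
    assume "\<not> ?thesis"
    then have nc: "\<nexists>c. colors k (E - {{x, y}}) c" "\<nexists>c. colors k (E - {{y, x}}) c"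
      "\<nexists>c. colors k (sw.E - {{x, y}}) c" "\<nexists>c. colors k (sw.E - {{y, x}}) c"
      using exy swE by (auto simp: insert_commute)
    have x: "x \<notin> A \<union> B"
      using x_notin_B[OF nc(1) xy] sw.x_notin_B[OF nc(3) xy] by blast
    have y: "y \<notin> A \<union> B"
      using x_notin_B[OF nc(2) yx xy(3,2)] sw.x_notin_B[OF nc(4) yx xy(3,2)] by blast
    have nonadj: "card (V0 - nb p) = card V0 - k" if "p \<in> V0" for p
      using card_Diff_subset[OF finite_nb, of p V0] nb_subset[of p] card_nb[OF that] by auto
    have kle: "k \<le> card V0"
      using card_mono[OF finV0, of "nb v"] nb_subset[of v] card_nb[OF vV0] by auto
    have V0pos: "card V0 > 0" using finV0 vV0 by (auto simp: card_gt_0_iff)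
    have fin: "finite (V0 - nb p)" for p using finV0 by simp
    \<comment> \<open>Two neighbourhoods have together at least \<open>3/2\<close> of all vertices,
      so they intersect.\<close>
    have common: "nb v \<inter> nb x \<noteq> {}"
    proof
      assume "nb v \<inter> nb x = {}"
      then have "card (nb v \<union> nb x) = 2 * k"
        using card_Un_disjoint[OF finite_nb finite_nb, of v x] card_nb vV0 xyV by simp
      moreover have "card (nb v \<union> nb x) \<le> card V0"
        using card_mono[OF finV0, of "nb v \<union> nb x"] nb_subset[of v] nb_subset[of x] by blast
      ultimately show False using dense V0pos by linarith
    qed
    have common4: "nb v \<inter> nb c \<inter> nb x \<inter> nb y \<noteq> {}" if c: "c \<in> V0" for c
    proof
      assume "nb v \<inter> nb c \<inter> nb x \<inter> nb y = {}"
      then have "V0 \<subseteq> ((V0 - nb v) \<union> (V0 - nb x)) \<union> ((V0 - nb c) \<union> (V0 - nb y))" by blast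
      then have "card V0 \<le> card (((V0 - nb v) \<union> (V0 - nb x)) \<union> ((V0 - nb c) \<union> (V0 - nb y)))"
        using fin by (intro card_mono) auto
      also have "\<dots> \<le> card ((V0 - nb v) \<union> (V0 - nb x)) + card ((V0 - nb c) \<union> (V0 - nb y))"
        by (rule card_Un_le)
      also have "card ((V0 - nb c) \<union> (V0 - nb y)) \<le> card (V0 - nb c) + card (V0 - nb y)"
        by (rule card_Un_le)
      finally have le: "card V0 \<le> card ((V0 - nb v) \<union> (V0 - nb x)) + 2 * (card V0 - k)"
        using nonadj[OF c] nonadj[OF xyV(2)] by simp
      \<comment> \<open>Each of the four sets of non-neighbours has at most a quarter of the
        vertices. Counting \<open>v\<close> in two of them makes the union too small to be
        \<open>V0\<close>.\<close>
      have "v \<notin> nb v" using nb_subset by blast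
      moreover have "v \<notin> nb x" using x nb_v unfolding nb_def by (auto simp: insert_commute)
      ultimately have "v \<in> (V0 - nb v) \<inter> (V0 - nb x)" using vV0 by blast
      then have "card ((V0 - nb v) \<inter> (V0 - nb x)) > 0" using fin by (auto simp: card_gt_0_iff)
      moreover have "card ((V0 - nb v) \<union> (V0 - nb x)) + card ((V0 - nb v) \<inter> (V0 - nb x)) = 2 * (card V0 - k)"
        using card_Un_Int[OF fin fin, of v x] nonadj[OF vV0] nonadj[OF xyV(1)] by simp
      ultimately show False using le dense kle by linarith
    qed
    obtain p q where p: "p \<in> A" and q: "q \<in> B" using AB by blast
    consider "A = {p}" | "B = {q}" | p' q' where "p' \<in> A" "p' \<noteq> p" "q' \<in> B" "q' \<noteq> q"
      using p q by blast
    then show False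
    proof cases
      case 1
      then show False using no_kite[OF nc(1) xy 1 x y] common4[of p] AB_V0[of p] p by blast
    next
      case 2
      have x': "x \<notin> B \<union> A" and y': "y \<notin> B \<union> A" using x y by blast+
      have "q \<in> V0" using AB_V0[of q] q by blast
      then show False
        using sw.no_kite[OF nc(3) xy 2 x' y'] common4[of q] by simp
    next
      case 3
      have "y \<notin> B" "y \<notin> A" using y by blast+
      then have "B \<inter> nb x = {}" "A \<inter> nb x = {}"
        using no_common_neighbor_in_B[OF nc(1) xy 3(1) p 3(2)]
          sw.no_common_neighbor_in_B[OF nc(3) xy 3(3) q 3(4)] by blast+
      then show False using common nb_v by blast
    qed
  qed
qed

end

subsection \<open>Criticality\<close>

lemma colors_imp_proper_edge_coloring:
  assumes "colors k E c" "edges H \<subseteq> E"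
  shows "proper_edge_coloring H k (\<lambda>e. the (c e))"
proof -
  have some: "c e = Some (the (c e))" if "e \<in> edges H" for e
    using that assms unfolding colors_def by (auto simp: dom_def)
  show ?thesis
    unfolding proper_edge_coloring_def
  proof (intro conjI subsetI ballI impI)
    fix t assume "t \<in> (\<lambda>e. the (c e)) ` edges H"
    then show "t \<in> {..<k}" using colors_lt[OF assms(1) some] by auto
  next
    fix e e' assume e: "e \<in> edges H" "e' \<in> edges H" "e \<noteq> e' \<and> e \<inter> e' \<noteq> {}"
    show "the (c e) \<noteq> the (c e')"
    proof
      assume "the (c e) = the (c e')"
      then have "c e = Some (the (c e))" "c e' = Some (the (c e))" using some e by metis+
      then show False using colors_proper[OF assms(1)] e(3) unfolding proper_map_def by blast
    qed
  qed
qed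

lemma proper_edge_coloring_imp_colors:
  assumes "proper_edge_coloring H k c"
  shows "colors k (edges H) (\<lambda>e. if e \<in> edges H then Some (c e) else None)"
  using assms unfolding colors_def proper_edge_coloring_def proper_map_def
  by (auto simp: dom_def ran_def split: if_splits)

lemma chromatic_index_le: "colors k E c \<Longrightarrow> edges H \<subseteq> E \<Longrightarrow> chromatic_index H \<le> k"
  unfolding chromatic_index_def using colors_imp_proper_edge_coloring by (metis Least_le)

lemma colors_mono: "colors k E c \<Longrightarrow> k \<le> l \<Longrightarrow> colors l E c"
  unfolding colors_def by force

lemma simple_graph_edge: "simple_graph H \<Longrightarrow> e \<in> edges H \<Longrightarrow> card e = 2 \<and> e \<subseteq> verts H"
  unfolding simple_graph_def by fastforce

text \<open>Numbering the finitely many edges injectively is a proper colouring, so the minimum in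
  \<open>chromatic_index\<close> is attained.\<close>

lemma chromatic_index_coloring:
  assumes "simple_graph H"
  shows "\<exists>c. colors (chromatic_index H) (edges H) c"
proof -
  have "edges H \<subseteq> Pow (verts H)" using simple_graph_edge[OF assms] by blast
  moreover have "finite (Pow (verts H))" using assms unfolding simple_graph_def by simp
  ultimately have "finite (edges H)" by (rule finite_subset)
  then obtain h :: "'a set \<Rightarrow> nat" and m where "h ` edges H = {i. i < m}" "inj_on h (edges H)"
    using finite_imp_inj_to_nat_seg by blast
  then have "proper_edge_coloring H m h"
    unfolding proper_edge_coloring_def by (auto simp: inj_on_def)
  then have "\<exists>c. proper_edge_coloring H (chromatic_index H) c"
    unfolding chromatic_index_def by (intro LeastI_ex[where P = "\<lambda>k. \<exists>c. proper_edge_coloring H k c"]) blast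
  then show ?thesis using proper_edge_coloring_imp_colors by blast
qed

lemma simple_graph_neighbors:
  assumes "simple_graph H"
  shows "neighbors H p = {u. {p, u} \<in> edges H}"
  unfolding neighbors_def using simple_graph_edge[OF assms] by blast

theorem theorem1p1:
  fixes n \<Delta> :: nat and G\<^sub>0 G :: "'a ugraph"
  assumes "n > 0" and "\<Delta> > 0"
    and "real \<Delta> \<ge> 3 * (real n - 1) / 4"
    and "simple_graph G\<^sub>0" and "card (verts G\<^sub>0) = n - 1"
    and "regular \<Delta> G\<^sub>0" and "class1 G\<^sub>0"
    and "vertex_splitting G\<^sub>0 G"
  shows "critical \<Delta> G"
proof -
  obtain v v\<^sub>1 v\<^sub>2 u t s where v: "v \<in> verts G\<^sub>0" "degree G\<^sub>0 v = t" "t \<ge> 2"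
      "bij_betw u {1..t} (neighbors G\<^sub>0 v)" "v\<^sub>1 \<notin> verts G\<^sub>0" "v\<^sub>2 \<notin> verts G\<^sub>0" "v\<^sub>1 \<noteq> v\<^sub>2"
      "s \<in> {1..t - 1}" and VG: "verts G = (verts G\<^sub>0 - {v}) \<union> {v\<^sub>1, v\<^sub>2}"
    and EG: "edges G = {e \<in> edges G\<^sub>0. v \<notin> e} \<union> {{v\<^sub>1, v\<^sub>2}}
                   \<union> {{v\<^sub>1, u i} | i. i \<in> {1..s}} \<union> {{v\<^sub>2, u i} | i. i \<in> {s + 1..t}}"
    using assms(8) unfolding vertex_splitting_def by (elim exE conjE) (rule that)
  have fin0: "finite (verts G\<^sub>0)" using assms(4) unfolding simple_graph_def by blast
  have deg0: "degree G\<^sub>0 p = \<Delta>" if "p \<in> verts G\<^sub>0" for p using that assms(6) unfolding regular_def by blast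
  have "degree G\<^sub>0 ` verts G\<^sub>0 = {\<Delta>}" using deg0 v(1) by auto
  \<comment> \<open>The vertex \<open>v\<close> shows that the graph is nonempty, so Class 1
    provides a colouring with exactly \<open>\<Delta>\<close> colours.\<close>
  then have "max_degree G\<^sub>0 = \<Delta>" unfolding max_degree_def by simp
  then have "chromatic_index G\<^sub>0 = \<Delta>" using assms(7) unfolding class1_def by simp
  then obtain \<phi> where \<phi>: "colors \<Delta> (edges G\<^sub>0) \<phi>" using chromatic_index_coloring[OF assms(4)] by auto
  note nb0 = simple_graph_neighbors[OF assms(4)]
  define A where "A = u ` {1..s}"
  define B where "B = u ` {s + 1..t}"
  have st: "1 \<le> s" "s < t" using v by auto
  have inj: "inj_on u {1..t}" and im: "u ` {1..t} = neighbors G\<^sub>0 v"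
    using v(4) unfolding bij_betw_def by auto
  have split: "{1..t} = {1..s} \<union> {s + 1..t}" using st by auto
  have un: "A \<union> B = neighbors G\<^sub>0 v" unfolding A_def B_def im[symmetric] split by (simp add: image_Un)
  have disj: "A \<inter> B = {}"
    unfolding A_def B_def using inj_on_image_Int[OF inj, of "{1..s}" "{s + 1..t}"] st by auto
  interpret split_graph "verts G\<^sub>0" "edges G\<^sub>0" v v\<^sub>1 v\<^sub>2 A B \<phi> \<Delta>
  proof unfold_locales
    show "card {u. {p, u} \<in> edges G\<^sub>0} = \<Delta>" if "p \<in> verts G\<^sub>0" for p
      using deg0[OF that] unfolding degree_def nb0 .
    show "A \<union> B = {u. {v, u} \<in> edges G\<^sub>0}" using un nb0 by simp
    show "A \<noteq> {}" "B \<noteq> {}" unfolding A_def B_def using st by auto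
  qed (use v fin0 simple_graph_edge[OF assms(4)] \<phi> disj in blast)+
  have E: "edges G = E" unfolding EG E_def unfolding A_def B_def by blast
  have V: "verts G = V" unfolding VG V_def ..
  have simple: "simple_graph G"
    unfolding simple_graph_def E V
  proof (intro conjI finV ballI)
    fix e assume "e \<in> E"
    then have "card e = 2" "e \<subseteq> V" using E_V by blast+
    then show "\<exists>x\<in>V. \<exists>y\<in>V. x \<noteq> y \<and> e = {x, y}" by (auto simp: card_2_iff)
  qed
  have degG: "degree G p = card {u. {p, u} \<in> E}" for p
    unfolding degree_def simple_graph_neighbors[OF simple] E ..
  have cardAB: "card A + card B = \<Delta>" "card A > 0" "card B > 0"
  proof -
    have fin: "finite A" "finite B" unfolding A_def B_def by auto
    then show "card A > 0" "card B > 0" using AB by (auto simp: card_gt_0_iff)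
    show "card A + card B = \<Delta>" using card_Un_disjoint[OF fin disj] card_nb[OF v(1)] nb_v by simp
  qed
  \<comment> \<open>Each half gains the edge to the other half but loses at least one old neighbour,
    as \<open>A\<close> and \<open>B\<close> are both nonempty.\<close>
  have "degree G v\<^sub>1 \<le> \<Delta>"
    unfolding degG nb_E_a using cardAB card_insert_le_m1[of "Suc (card A)" A v\<^sub>2] by auto
  moreover have "degree G v\<^sub>2 \<le> \<Delta>"
  proof -
    interpret sw: split_graph "verts G\<^sub>0" "edges G\<^sub>0" v v\<^sub>2 v\<^sub>1 B A \<phi> \<Delta> by (rule swapped)
    show ?thesis
      unfolding degG using cardAB card_insert_le_m1[of "Suc (card B)" B v\<^sub>1] sw.nb_E_a swapped_E by auto
  qed
  moreover have degV: "degree G p = \<Delta>" if "p \<in> verts G\<^sub>0 - {v}" for p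
    unfolding degG using card_nb_E[OF that] .
  ultimately have le: "degree G p \<le> \<Delta>" if "p \<in> verts G" for p
    using that unfolding V V_def by auto
  obtain p where "p \<in> A" using AB by blast
  then have p: "p \<in> verts G\<^sub>0 - {v}" using AB_V0 by blast
  have max: "max_degree G = \<Delta>"
    unfolding max_degree_def
  proof (rule Max_eqI)
    have "p \<in> verts G" using p unfolding VG by blast
    then show "\<Delta> \<in> insert 0 (degree G ` verts G)" using degV[OF p] by auto
  qed (use le finV V in auto)
  \<comment> \<open>Colours are the numbers below \<open>k\<close>, so \<open>\<Delta>\<close>
    itself is fresh and serves the one uncoloured edge.\<close>
  have "colors (\<Delta> + 1) E (f({v\<^sub>1, v\<^sub>2} \<mapsto> \<Delta>))"
  proof (rule colors_color)
    show "colors (\<Delta> + 1) (E - {{v\<^sub>1, v\<^sub>2}}) f" using colors_mono[OF f_colors] by simp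
    show "miss f q \<Delta>" for q using colors_lt[OF f_colors] unfolding miss_def by blast
  qed (use ab_E in auto)
  then have upper: "chromatic_index G \<le> \<Delta> + 1" using chromatic_index_le E by blast
  have lower: "\<not> chromatic_index G \<le> \<Delta>"
    using chromatic_index_coloring[OF simple] colors_mono not_colorable unfolding E by blast
  have "3 * (n - 1) \<le> 4 * \<Delta>"
  proof -
    \<comment> \<open>As \<open>n\<close> is positive, the truncated difference \<open>n - 1\<close>
      agrees with the real one.\<close>
    have "real (3 * (n - 1)) \<le> real (4 * \<Delta>)" using assms(1,3) by (simp add: of_nat_diff field_simps)
    then show ?thesis by linarith
  qed
  then have dense: "3 * card (verts G\<^sub>0) \<le> 4 * \<Delta>" using assms(5) by simp
  have "chromatic_index H < \<Delta> + 1" if H: "subgraph H G" "H \<noteq> G" for H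
  proof -
    have "simple_graph H" and sub: "verts H \<subseteq> V" "edges H \<subseteq> E"
      using H(1) unfolding subgraph_def V E by auto
    \<comment> \<open>There are no isolated vertices, so a subgraph with all edges has all vertices;
      a proper subgraph must lack an edge.\<close>
    have "edges H \<noteq> E"
    proof
      assume EH: "edges H = E"
      have "q \<in> verts H" if q: "q \<in> V" for q
      proof -
        have "\<exists>e\<in>E. q \<in> e"
        proof (cases "q \<in> {v\<^sub>1, v\<^sub>2}")
          case False
          then have "q \<in> verts G\<^sub>0 - {v}" using q unfolding V_def by blast
          then have "{u. {q, u} \<in> E} \<noteq> {}" using card_nb_E[of q] k_pos by force
          then show ?thesis by blast
        qed (use ab_E in blast)
        then show ?thesis using simple_graph_edge[OF \<open>simple_graph H\<close>] EH by blast
      qed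
      then have "verts H = verts G" using sub V by blast
      then show False using H(2) EH E by simp
    qed
    then obtain e where e: "e \<in> E" "edges H \<subseteq> E - {e}" using sub by blast
    obtain c where "colors \<Delta> (E - {e}) c" using colorable_delete[OF dense e(1)] by blast
    then show ?thesis using chromatic_index_le[of \<Delta> "E - {e}" c H] e(2) by simp
  qed
  then show ?thesis unfolding critical_def using simple max upper lower by auto
qed

end
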